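(* Let $n\ge1$. Given any $E\in\mathbb R$, there exists a unique reflective rotationally symmetric hypersurface in $H_n$ with $p$-mean curvature $H=0$ and with energy $E$ (uniqueness meaning that the generating curves of its two parts are determined up to translations along the $t$-axis). The corresponding generating curve is $$x(\tilde s)=F_E(\tilde s),\qquad t(\tilde s)=\int\frac{E}{x^{2n-2}}\,d\tilde s .$$ Here the horizontal arc-length $\tilde s=G_E(x)$ is an antiderivative with respect to $x$ of $$\pm\frac{1}{\sqrt{1-\left(\frac{E}{x^{2n-1}}\right)^2}},\qquad x>|E|^{\frac1{2n-1}},$$ $F_E$ is the inverse function of $G_E$, and the two signs $+,-$ give the generating curves of the two parts $\Sigma^+$ and $\Sigma^-$ of the hypersurface.
   Context: The Heisenberg group $H_n$ is $\mathbb R^{2n+1}$ with coordinates $(x_1,\dots,x_n,y_1,\dots,y_n,t)$, $z=(x_1+iy_1,\dots,x_n+iy_n)$, contact form $\Theta=dt+\sum_{j}(x_jdy_j-y_jdx_j)$, contact bundle $\xi=\ker\Theta$, and left-invariant fields $\mathring e_\beta=\partial_{x_\beta}+y_\beta\partial_t$, $\mathring e_{n+\beta}=\partial_{y_\beta}-x_\beta\partial_t$, $T=\partial_t$. $J\mathring e_\beta=\mathring e_{n+\beta}$, $J\mathring e_{n+\beta}=-\mathring e_\beta$; the Levi metric $G$ on $\xi$ makes $\mathring e_1,\dots,\mathring e_{2n}$ orthonormal; $\nabla$ is the flat connection for which all $\mathring e_a$ and $T$ are parallel. $U(n)$ acts by $(z,t)\mapsto(Az,t)$. A rotationally symmetric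 hypersurface is one invariant under $U(n)$, generated by a smooth regular curve $(x(s),t(s))$, $x>0$, in the $x_nt$-plane: $\Sigma=\{(z,t):(|z|,t)=(x(s),t(s))\text{ for some }s\}$ (only regular points, $x>0$, are considered). The horizontal generating curve is $\tilde\gamma(s)=(0,\dots,0,x\cos\theta(s),0,\dots,0,x\sin\theta(s),t(s))$ with $\theta'=-t'/x^2$, so $\tilde\gamma'\in\xi$; the horizontal arc-length $\tilde s$ is the parameter with $|\tilde\gamma'|_G=1$, i.e. $(dx/d\tilde s)^2+x^{-2}(dt/d\tilde s)^2=1$. Invariants. Let $\xi'=(\xi\cap T\Sigma)\cap J(\xi\cap T\Sigma)$, let $e_n\in\xi\cap T\Sigma$ be the unit vector $G$-orthogonal to $\xi'$ with orientation given by $\tilde\gamma'$, and $e_{2n}=Je_n$. Define $\alpha$ by $\alpha e_{2n}+T\in T\Sigma$, $l$ by $-\nabla_{e_n}e_{2n}=l\,e_n$, and, for $n\ge2$, $k$ as the common eigenvalue on $\xi'$ of $v\mapsto-\nabla_ve_{2n}+\alpha Jv$ (it exists for rotationally symmetric hypersurfaces); for $n=1$, $k=\frac{-t'}{x\sqrt{(xx')^2+(t')^2}}$ (the formula valid for $n\ge 2$). The $p$-mean curvature is $H=l+(2n-2)k$. Energy. If $H=2n\lambda$ is constant, the energy is $E=(\lambda-k)x^{2n}$, which is constant along the generating curve; for $H=0$, $E=-kx^{2n}$. Reflective: a rotationally symmetric hypersurface is called reflective if $\Sigma=\Sigma^+\cup\Sigma^-$, where the two (possibly disjoint) parts are interchanged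 by the reflection $(z,t)\mapsto(z,-t)$, with $\alpha\ge 0$ on $\Sigma^+$ and $\alpha\le0$ on $\Sigma^-$ and the same $k,l$ as functions of $|z|$; in the paper's normalization $\Sigma^\pm=\{t=\pm\sqrt{f(|z|^2)}\}$ for a function $f$. The generating curves $\gamma^\pm$ of $\Sigma^\pm$ are considered up to translation along the $t$-axis, and taken over the whole range $x>|E|^{1/(2n-1)}$. *)

theory Defs
  imports "HOL-Analysis.Analysis"
begin

subsection \<open>The Heisenberg group\<close>

text \<open>A point or a tangent vector of \<open>H\<^sub>n\<close> is a pair \<open>(z, t)\<close> with
  \<open>z\<^sub>\<beta> = x\<^sub>\<beta> + i y\<^sub>\<beta>\<close>; the dimension is \<open>n = CARD('n) \<ge> 1\<close>.\<close>

type_synonym 'n heis = "(complex ^ 'n) \<times> real"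

definition contact_form :: "'n::finite heis \<Rightarrow> 'n heis \<Rightarrow> real" where
  "contact_form p V = snd V +
     (\<Sum>j\<in>UNIV. Re (fst p $ j) * Im (fst V $ j) - Im (fst p $ j) * Re (fst V $ j))"

definition contact_bundle :: "'n::finite heis \<Rightarrow> 'n heis set" where
  "contact_bundle p = {V. contact_form p V = 0}"

definition frame_x :: "'n::finite \<Rightarrow> 'n heis \<Rightarrow> 'n heis" where
  "frame_x \<beta> p = (axis \<beta> 1, Im (fst p $ \<beta>))"

definition frame_y :: "'n::finite \<Rightarrow> 'n heis \<Rightarrow> 'n heis" where
  "frame_y \<beta> p = (axis \<beta> \<i>, - Re (fst p $ \<beta>))"

definition reeb :: "'n::finite heis" where
  "reeb = (0, 1)"

definition from_frame :: "'n::finite heis \<Rightarrow> (complex ^ 'n) \<times> real \<Rightarrow> 'n heis" where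
  "from_frame p a =
     (\<Sum>\<beta>\<in>UNIV. Re (fst a $ \<beta>) *\<^sub>R frame_x \<beta> p + Im (fst a $ \<beta>) *\<^sub>R frame_y \<beta> p) + snd a *\<^sub>R reeb"

text \<open>The coefficients of a tangent vector at \<open>p\<close> in the left-invariant frame; the coefficients of
  \<open>frame_x \<beta>\<close> and \<open>frame_y \<beta>\<close> are the real and imaginary part of the \<open>\<beta>\<close>-th complex entry.\<close>

definition frame_coords :: "'n::finite heis \<Rightarrow> 'n heis \<Rightarrow> (complex ^ 'n) \<times> real" where
  "frame_coords p V = (fst V, contact_form p V)"

lemma from_frame_eq:
  "from_frame p a = (fst a, snd a -
     (\<Sum>j\<in>UNIV. Re (fst p $ j) * Im (fst a $ j) - Im (fst p $ j) * Re (fst a $ j)))"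
proof -
  have "fst (from_frame p a) $ i = fst a $ i" for i
  proof -
    have "fst (from_frame p a) $ i = (\<Sum>\<beta>\<in>UNIV. Re (fst a $ \<beta>) *\<^sub>R (axis \<beta> 1 $ i)
        + Im (fst a $ \<beta>) *\<^sub>R (axis \<beta> \<i> $ i))"
      by (simp add: from_frame_def fst_sum frame_x_def frame_y_def reeb_def)
    also have "\<dots> = (\<Sum>\<beta>\<in>UNIV. if \<beta> = i then fst a $ \<beta> else 0)"
      by (intro sum.cong) (auto simp: axis_def complex_eq_iff)
    finally show ?thesis
      by simp
  qed
  moreover have "snd (from_frame p a) = snd a -
     (\<Sum>j\<in>UNIV. Re (fst p $ j) * Im (fst a $ j) - Im (fst p $ j) * Re (fst a $ j))"
    by (simp add: from_frame_def snd_sum frame_x_def frame_y_def reeb_def sum.distrib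
        sum_subtractf sum_negf algebra_simps)
  ultimately show ?thesis
    by (simp add: prod_eq_iff vec_eq_iff)
qed

lemma frame_coords_from_frame: "frame_coords p (from_frame p a) = a"
  by (simp add: frame_coords_def from_frame_eq contact_form_def)

lemma from_frame_frame_coords: "from_frame p (frame_coords p V) = V"
  by (simp add: frame_coords_def from_frame_eq contact_form_def)

text \<open>The complex structure and the Levi metric are meant on the contact bundle only.\<close>

definition cstr :: "'n::finite heis \<Rightarrow> 'n heis \<Rightarrow> 'n heis" where
  "cstr p V = from_frame p (\<i> *s fst (frame_coords p V), 0)"

definition levi :: "'n::finite heis \<Rightarrow> 'n heis \<Rightarrow> 'n heis \<Rightarrow> real" where
  "levi p V W = inner (fst (frame_coords p V)) (fst (frame_coords p W))"

lemma cstr_frame: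
  "cstr p (frame_x \<beta> p) = frame_y \<beta> p" "cstr p (frame_y \<beta> p) = - frame_x \<beta> p"
proof -
  have 1: "\<i> *s axis \<beta> 1 = axis \<beta> \<i>" "\<i> *s axis \<beta> \<i> = - axis \<beta> (1::complex)"
    by (auto simp: vec_eq_iff axis_def)
  have "(\<Sum>j\<in>UNIV. Re (fst p $ j) * Im (axis \<beta> \<i> $ j) - Im (fst p $ j) * Re (axis \<beta> \<i> $ j))
       = (\<Sum>j\<in>UNIV. if j = \<beta> then Re (fst p $ j) else 0)"
    by (intro sum.cong) (auto simp: axis_def)
  then have 2: "(\<Sum>j\<in>UNIV. Re (fst p $ j) * Im (axis \<beta> \<i> $ j) - Im (fst p $ j) * Re (axis \<beta> \<i> $ j))
       = Re (fst p $ \<beta>)"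
    by simp
  have "(\<Sum>j\<in>UNIV. Re (fst p $ j) * Im ((- axis \<beta> (1::complex)) $ j) - Im (fst p $ j) * Re ((- axis \<beta> (1::complex)) $ j))
       = (\<Sum>j\<in>UNIV. if j = \<beta> then Im (fst p $ j) else 0)"
    by (intro sum.cong) (auto simp: axis_def)
  then have 3: "(\<Sum>j\<in>UNIV. Re (fst p $ j) * Im ((- axis \<beta> (1::complex)) $ j) - Im (fst p $ j) * Re ((- axis \<beta> (1::complex)) $ j))
       = Im (fst p $ \<beta>)"
    by simp
  show "cstr p (frame_x \<beta> p) = frame_y \<beta> p"
    unfolding cstr_def frame_coords_def from_frame_eq frame_x_def frame_y_def fst_conv snd_conv 1 2 by simp
  show "cstr p (frame_y \<beta> p) = - frame_x \<beta> p"
    unfolding cstr_def frame_coords_def from_frame_eq frame_x_def frame_y_def fst_conv snd_conv 1 3 by simp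
qed

lemma levi_frame:
  "levi p (frame_x \<beta> p) (frame_x \<delta> p) = (if \<beta> = \<delta> then 1 else 0)"
  "levi p (frame_y \<beta> p) (frame_y \<delta> p) = (if \<beta> = \<delta> then 1 else 0)"
  "levi p (frame_x \<beta> p) (frame_y \<delta> p) = 0"
  by (simp_all add: levi_def frame_coords_def frame_x_def frame_y_def inner_axis_axis)

subsection \<open>Tangent spaces and the flat connection\<close>

definition curve_in :: "'n::finite heis set \<Rightarrow> 'n heis \<Rightarrow> 'n heis \<Rightarrow> (real \<Rightarrow> 'n heis) \<Rightarrow> bool" where
  "curve_in S p v c \<longleftrightarrow>
     c 0 = p \<and> (\<forall>\<^sub>F s in at 0. c s \<in> S) \<and> (c has_vector_derivative v) (at 0)"

definition tangent_space :: "'n::finite heis set \<Rightarrow> 'n heis \<Rightarrow> 'n heis set" where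
  "tangent_space S p = {v. \<exists>c. curve_in S p v c}"

text \<open>\<open>has_nabla S X p v D\<close>: the field \<open>X\<close> along \<open>S\<close> satisfies \<open>\<nabla>\<^sub>v X = D\<close> at \<open>p\<close>, where
  \<open>v\<close> is tangent to \<open>S\<close>. Since the frame is parallel, this means differentiating frame coefficients
  along curves in \<open>S\<close> with velocity \<open>v\<close>. It determines \<open>D\<close> when \<open>v \<in> tangent_space S p\<close>.\<close>

definition has_nabla ::
  "'n::finite heis set \<Rightarrow> ('n heis \<Rightarrow> 'n heis) \<Rightarrow> 'n heis \<Rightarrow> 'n heis \<Rightarrow> 'n heis \<Rightarrow> bool" where
  "has_nabla S X p v D \<longleftrightarrow>
     (\<forall>c. curve_in S p v c \<longrightarrow>
        ((\<lambda>s. frame_coords (c s) (X (c s))) has_vector_derivative frame_coords p D) (at 0))"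

subsection \<open>Rotationally symmetric hypersurfaces\<close>

definition smooth_curve_on :: "real set \<Rightarrow> (real \<Rightarrow> real) \<Rightarrow> bool" where
  "smooth_curve_on I f \<longleftrightarrow> (\<forall>k. \<forall>s\<in>I. ((deriv ^^ k) f) field_differentiable (at s))"

text \<open>A generating curve \<open>\<gamma> = (x, t)\<close> is given on an open interval \<open>I\<close>; values of \<open>\<gamma>\<close> outside
  \<open>I\<close> are irrelevant.\<close>

abbreviation xcomp :: "(real \<Rightarrow> real \<times> real) \<Rightarrow> real \<Rightarrow> real" where
  "xcomp \<gamma> \<equiv> (\<lambda>s. fst (\<gamma> s))"

abbreviation tcomp :: "(real \<Rightarrow> real \<times> real) \<Rightarrow> real \<Rightarrow> real" where
  "tcomp \<gamma> \<equiv> (\<lambda>s. snd (\<gamma> s))"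

definition generating_curve :: "real set \<Rightarrow> (real \<Rightarrow> real \<times> real) \<Rightarrow> bool" where
  "generating_curve I \<gamma> \<longleftrightarrow>
     open I \<and> is_interval I \<and> I \<noteq> {} \<and>
     smooth_curve_on I (xcomp \<gamma>) \<and> smooth_curve_on I (tcomp \<gamma>) \<and>
     (\<forall>s\<in>I. xcomp \<gamma> s > 0) \<and>
     (\<forall>s\<in>I. deriv (xcomp \<gamma>) s \<noteq> 0 \<or> deriv (tcomp \<gamma>) s \<noteq> 0)"

definition rot_surface :: "real set \<Rightarrow> (real \<Rightarrow> real \<times> real) \<Rightarrow> 'n::finite heis set" where
  "rot_surface I \<gamma> = {p. \<exists>s\<in>I. (norm (fst p), snd p) = \<gamma> s}"

definition horizontal_arclength :: "real set \<Rightarrow> (real \<Rightarrow> real \<times> real) \<Rightarrow> bool" where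
  "horizontal_arclength I \<gamma> \<longleftrightarrow>
     (\<forall>s\<in>I. (deriv (xcomp \<gamma>) s)\<^sup>2 + (deriv (tcomp \<gamma>) s)\<^sup>2 / (xcomp \<gamma> s)\<^sup>2 = 1)"

text \<open>For \<open>u\<close> the last standard basis vector this is the horizontal generating curve; its images
  under \<open>U(n)\<close> are the same curves for arbitrary unit vectors \<open>u\<close>, and they foliate the hypersurface.\<close>

definition horizontal_curve ::
  "(real \<Rightarrow> real \<times> real) \<Rightarrow> (real \<Rightarrow> real) \<Rightarrow> complex ^ 'n \<Rightarrow> real \<Rightarrow> 'n::finite heis" where
  "horizontal_curve \<gamma> \<theta> u s = ((complex_of_real (xcomp \<gamma> s) * cis (\<theta> s)) *s u, tcomp \<gamma> s)"

definition horizontal_velocity ::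
  "real set \<Rightarrow> (real \<Rightarrow> real \<times> real) \<Rightarrow> 'n::finite heis \<Rightarrow> 'n heis \<Rightarrow> bool" where
  "horizontal_velocity I \<gamma> p v \<longleftrightarrow>
     (\<exists>\<theta> u. \<exists>s\<in>I. norm u = 1 \<and>
        (\<forall>r\<in>I. (\<theta> has_real_derivative - deriv (tcomp \<gamma>) r / (xcomp \<gamma> r)\<^sup>2) (at r)) \<and>
        horizontal_curve \<gamma> \<theta> u s = p \<and>
        (horizontal_curve \<gamma> \<theta> u has_vector_derivative v) (at s))"

subsection \<open>Invariants\<close>

definition xi_tangent :: "'n::finite heis set \<Rightarrow> 'n heis \<Rightarrow> 'n heis set" where
  "xi_tangent S p = contact_bundle p \<inter> tangent_space S p"

definition xi_prime :: "'n::finite heis set \<Rightarrow> 'n heis \<Rightarrow> 'n heis set" where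
  "xi_prime S p = xi_tangent S p \<inter> cstr p ` xi_tangent S p"

definition e_n :: "real set \<Rightarrow> (real \<Rightarrow> real \<times> real) \<Rightarrow> 'n::finite heis \<Rightarrow> 'n heis" where
  "e_n I \<gamma> p = (THE v. v \<in> xi_tangent (rot_surface I \<gamma>) p \<and> levi p v v = 1 \<and>
     (\<forall>w\<in>xi_prime (rot_surface I \<gamma>) p. levi p v w = 0) \<and>
     (\<exists>g. horizontal_velocity I \<gamma> p g \<and> levi p v g > 0))"

definition e_2n :: "real set \<Rightarrow> (real \<Rightarrow> real \<times> real) \<Rightarrow> 'n::finite heis \<Rightarrow> 'n heis" where
  "e_2n I \<gamma> p = cstr p (e_n I \<gamma> p)"

definition inv_alpha :: "real set \<Rightarrow> (real \<Rightarrow> real \<times> real) \<Rightarrow> 'n::finite heis \<Rightarrow> real" where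
  "inv_alpha I \<gamma> p = (THE a. a *\<^sub>R e_2n I \<gamma> p + reeb \<in> tangent_space (rot_surface I \<gamma>) p)"

definition inv_l :: "real set \<Rightarrow> (real \<Rightarrow> real \<times> real) \<Rightarrow> 'n::finite heis \<Rightarrow> real" where
  "inv_l I \<gamma> p = (THE l. \<exists>D. has_nabla (rot_surface I \<gamma>) (e_2n I \<gamma>) p (e_n I \<gamma> p) D \<and>
     - D = l *\<^sub>R e_n I \<gamma> p)"

definition inv_k :: "real set \<Rightarrow> (real \<Rightarrow> real \<times> real) \<Rightarrow> 'n::finite heis \<Rightarrow> real" where
  "inv_k I \<gamma> p =
     (if CARD('n) \<ge> 2
      then (THE k. \<forall>v\<in>xi_prime (rot_surface I \<gamma>) p.
              \<exists>D. has_nabla (rot_surface I \<gamma>) (e_2n I \<gamma>) p v D \<and>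
                  - D + inv_alpha I \<gamma> p *\<^sub>R cstr p v = k *\<^sub>R v)
      else (THE k. \<exists>s\<in>I. (norm (fst p), snd p) = \<gamma> s \<and>
              k = - deriv (tcomp \<gamma>) s /
                  (xcomp \<gamma> s * sqrt ((xcomp \<gamma> s * deriv (xcomp \<gamma>) s)\<^sup>2 + (deriv (tcomp \<gamma>) s)\<^sup>2))))"

definition p_mean_curvature :: "real set \<Rightarrow> (real \<Rightarrow> real \<times> real) \<Rightarrow> 'n::finite heis \<Rightarrow> real" where
  "p_mean_curvature I \<gamma> p = inv_l I \<gamma> p + (2 * real CARD('n) - 2) * inv_k I \<gamma> p"

text \<open>\<open>\<lambda> = H / (2n)\<close>; this is only used for constant \<open>H\<close>.\<close>

definition energy :: "real set \<Rightarrow> (real \<Rightarrow> real \<times> real) \<Rightarrow> 'n::finite heis \<Rightarrow> real" where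
  "energy I \<gamma> p =
     (p_mean_curvature I \<gamma> p / (2 * real CARD('n)) - inv_k I \<gamma> p) * norm (fst p) ^ (2 * CARD('n))"

subsection \<open>Reflective hypersurfaces\<close>

definition reflection :: "'n::finite heis \<Rightarrow> 'n heis" where
  "reflection p = (fst p, - snd p)"

text \<open>The parts are \<open>\<Sigma>\<^sup>+ = rot_surface Iplus \<gamma>plus\<close> and \<open>\<Sigma>\<^sup>- = rot_surface Iminus \<gamma>minus\<close>. Injectivity of
  the \<open>x\<close>-component says that each part is a graph over \<open>\<bar>z\<bar>\<close>. The normalisation
  \<open>t = \<plusminus> sqrt (f (\<bar>z\<bar>\<^sup>2))\<close> is not required here; it fixes the translation along the \<open>t\<close>-axis
  and is the separate notion \<open>sqrt_normalised\<close>.\<close>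

definition reflective ::
  "'n::finite heis set \<Rightarrow> real set \<Rightarrow> (real \<Rightarrow> real \<times> real) \<Rightarrow>
     real set \<Rightarrow> (real \<Rightarrow> real \<times> real) \<Rightarrow> bool" where
  "reflective S Iplus \<gamma>plus Iminus \<gamma>minus \<longleftrightarrow>
     generating_curve Iplus \<gamma>plus \<and> generating_curve Iminus \<gamma>minus \<and>
     inj_on (xcomp \<gamma>plus) Iplus \<and> inj_on (xcomp \<gamma>minus) Iminus \<and>
     S = rot_surface Iplus \<gamma>plus \<union> rot_surface Iminus \<gamma>minus \<and>
     reflection ` (rot_surface Iplus \<gamma>plus :: 'n heis set) = rot_surface Iminus \<gamma>minus \<and>
     (\<forall>p\<in>rot_surface Iplus \<gamma>plus :: 'n heis set. inv_alpha Iplus \<gamma>plus p \<ge> 0) \<and>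
     (\<forall>q\<in>rot_surface Iminus \<gamma>minus :: 'n heis set. inv_alpha Iminus \<gamma>minus q \<le> 0) \<and>
     (\<forall>p\<in>rot_surface Iplus \<gamma>plus :: 'n heis set. \<forall>q\<in>rot_surface Iminus \<gamma>minus :: 'n heis set.
        norm (fst p) = norm (fst q) \<longrightarrow>
          inv_k Iplus \<gamma>plus p = inv_k Iminus \<gamma>minus q \<and> inv_l Iplus \<gamma>plus p = inv_l Iminus \<gamma>minus q)"

definition x_range :: "nat \<Rightarrow> real \<Rightarrow> real set" where
  "x_range n E = {x. x > \<bar>E\<bar> powr (1 / (2 * real n - 1))}"

definition reflective_minimal ::
  "real \<Rightarrow> 'n::finite heis set \<Rightarrow> real set \<Rightarrow> (real \<Rightarrow> real \<times> real) \<Rightarrow>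
     real set \<Rightarrow> (real \<Rightarrow> real \<times> real) \<Rightarrow> bool" where
  "reflective_minimal E S Iplus \<gamma>plus Iminus \<gamma>minus \<longleftrightarrow>
     reflective S Iplus \<gamma>plus Iminus \<gamma>minus \<and>
     xcomp \<gamma>plus ` Iplus = x_range CARD('n) E \<and> xcomp \<gamma>minus ` Iminus = x_range CARD('n) E \<and>
     (\<forall>p\<in>rot_surface Iplus \<gamma>plus :: 'n heis set.
        p_mean_curvature Iplus \<gamma>plus p = 0 \<and> energy Iplus \<gamma>plus p = E) \<and>
     (\<forall>q\<in>rot_surface Iminus \<gamma>minus :: 'n heis set.
        p_mean_curvature Iminus \<gamma>minus q = 0 \<and> energy Iminus \<gamma>minus q = E)"

text \<open>\<open>P = {t = sqrt (f (\<bar>z\<bar>\<^sup>2))}\<close> and \<open>N = {t = - sqrt (f (\<bar>z\<bar>\<^sup>2))}\<close> over \<open>\<bar>z\<bar> \<in> X\<close>. Along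
  \<open>\<Sigma>\<^sup>+\<close> the function \<open>t\<close> is monotone in \<open>\<bar>z\<bar>\<close> with the sign of \<open>E\<close>, so for \<open>E < 0\<close> it is
  \<open>\<Sigma>\<^sup>-\<close> that takes the role of \<open>P\<close> (for \<open>n = 1\<close> and \<open>E < 0\<close>, \<open>t\<close> is unbounded below on \<open>\<Sigma>\<^sup>+\<close>).\<close>

definition sqrt_normalised :: "real set \<Rightarrow> 'n::finite heis set \<Rightarrow> 'n heis set \<Rightarrow> bool" where
  "sqrt_normalised X P N \<longleftrightarrow>
     (\<exists>f :: real \<Rightarrow> real. (\<forall>r\<in>X. f (r\<^sup>2) \<ge> 0) \<and>
        P = {p. norm (fst p) \<in> X \<and> snd p = sqrt (f ((norm (fst p))\<^sup>2))} \<and>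
        N = {p. norm (fst p) \<in> X \<and> snd p = - sqrt (f ((norm (fst p))\<^sup>2))})"

text \<open>The explicit curve \<open>x = F\<^sub>E(s)\<close>, \<open>t = \<integral> E / x\<^sup>2\<^sup>n\<^sup>-\<^sup>2 ds\<close>, where \<open>F\<^sub>E\<close> is the inverse of
  an antiderivative \<open>G\<close> and \<open>\<sigma> = 1\<close> or \<open>\<sigma> = - 1\<close> is the chosen sign.\<close>

definition explicit_curve ::
  "nat \<Rightarrow> real \<Rightarrow> real \<Rightarrow> real set \<Rightarrow> (real \<Rightarrow> real \<times> real) \<Rightarrow> bool" where
  "explicit_curve n E \<sigma> I \<gamma> \<longleftrightarrow>
     (\<exists>G. (\<forall>x\<in>x_range n E.
             (G has_real_derivative \<sigma> / sqrt (1 - (E / x ^ (2 * n - 1))\<^sup>2)) (at x)) \<and>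
          inj_on G (x_range n E) \<and> I = G ` x_range n E \<and>
          (\<forall>s\<in>I. xcomp \<gamma> s = inv_into (x_range n E) G s) \<and>
          (\<forall>s\<in>I. (tcomp \<gamma> has_real_derivative E / xcomp \<gamma> s ^ (2 * n - 2)) (at s)))"

definition translate_t :: "real \<Rightarrow> real \<times> real \<Rightarrow> real \<times> real" where
  "translate_t c a = (fst a, snd a + c)"

end

theory Submission
  imports Defs
begin

text \<open>
  Everything reduces to one complex-valued function on the generating curve \<open>(x, t)\<close>, its phase
  \<open>e\<^sup>i\<^sup>\<psi> = (t' + \<i> x x') / D\<close> with \<open>D\<^sup>2 = (x x')\<^sup>2 + t'\<^sup>2\<close>. At a point \<open>(z, t)\<close> of the hypersurface
  the tangent space is the kernel of the form sending \<open>(w, \<tau>)\<close> to \<open>t' \<langle>z, w\<rangle> - x x' \<tau>\<close>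
  (\<open>tangent_space_rot_surface\<close>), and on the contact bundle this form is a multiple of
  \<open>\<langle>e\<^sup>i\<^sup>\<psi> z, w\<rangle>\<close>. Thus \<open>e\<^sub>2\<^sub>n\<close> is the horizontal lift of \<open>e\<^sup>i\<^sup>\<psi> z / x\<close> and \<open>e\<^sub>n\<close> that of
  \<open>- \<i> e\<^sup>i\<^sup>\<psi> z / x\<close>. Differentiating the frame coefficients along curves in the hypersurface
  (\<open>nabla_e_2n_iff\<close>) gives, in \<open>inv_alpha_eq\<close>, \<open>inv_k_eq\<close> and \<open>inv_l_eq\<close>, the formulas
  \<open>\<alpha> = x' / D\<close>, \<open>k = - t' / (x D)\<close> and \<open>l = (x \<psi>' - t' / x) / D\<close>.

  If \<open>H = 0\<close> and the energy is \<open>E\<close>, then \<open>cos \<psi> = t' / D = E / x\<^sup>2\<^sup>n\<^sup>-\<^sup>1\<close>, hence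
  \<open>x x' / D = \<plusminus> sqrt (1 - (E / x\<^sup>2\<^sup>n\<^sup>-\<^sup>1)\<^sup>2)\<close>, the sign being that of \<open>\<alpha>\<close> (\<open>minimal_phase\<close>). Over
  \<open>x > |E|\<^bsup>1/(2n-1)\<^esup>\<close> this is nonzero, so each part is a graph \<open>t = \<tau>(x)\<close> whose slope
  \<open>d\<tau>/dx = \<plusminus> E / (x\<^sup>2\<^sup>n\<^sup>-\<^sup>2 sqrt (1 - (E / x\<^sup>2\<^sup>n\<^sup>-\<^sup>1)\<^sup>2))\<close> is known (\<open>graph_slope\<close>): it is unique up to
  translation, and the reflection ties the two translations together. In horizontal arc-length \<open>D = x\<close>, so
  \<open>x' = \<plusminus> sqrt (1 - (E / x\<^sup>2\<^sup>n\<^sup>-\<^sup>1)\<^sup>2)\<close> and \<open>t' = E / x\<^sup>2\<^sup>n\<^sup>-\<^sup>2\<close>, which is the explicit curve.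

  Conversely, along an explicit curve the phase turns with angular speed \<open>\<psi>' = (2 n - 1) cos \<psi> / x\<close>; this makes
  \<open>l + (2 n - 2) k\<close> vanish, while \<open>- k x\<^sup>2\<^sup>n = E\<close> holds by construction (\<open>explicit_curve_minimal\<close>).
  The normal form \<open>t = \<plusminus> sqrt (f (|z|\<^sup>2))\<close> needs in addition that the profile stays bounded at the inner
  end of its range; its slope has only an inverse square root singularity there
  (\<open>profile_primitive_nonneg\<close>).
\<close>

section \<open>Reparametrisations, inverses and primitives on the real line\<close>


text \<open>Caratheodory's factorisation of \<open>f\<close> at \<open>s a\<close> can be solved for the difference quotient of \<open>s\<close>,
  without a local inverse of \<open>f\<close>. So \<open>f\<close> may be any component of a curve, while the continuity of \<open>s\<close>
  is supplied by another one.\<close>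

lemma reparametrisation_derivative:
  fixes f s y :: "real \<Rightarrow> real"
  assumes f: "(f has_real_derivative d) (at (s a))" and "d \<noteq> 0" and s: "isCont s a"
    and y: "(y has_real_derivative e) (at a)"
    and eq: "\<forall>\<^sub>F r in at a. f (s r) = y r" "f (s a) = y a"
  shows "(s has_real_derivative e / d) (at a)"
proof -
  obtain g where g: "\<And>z. f z - f (s a) = g z * (z - s a)" "isCont g (s a)" "g (s a) = d"
    using f CARAT_DERIV by metis
  have lim: "((\<lambda>r. g (s r)) \<longlongrightarrow> d) (at a)"
    using isCont_tendsto_compose[OF g(2) isContD[OF s]] g(3) by simp
  then have nz: "\<forall>\<^sub>F r in at a. g (s r) \<noteq> 0"
    using \<open>d \<noteq> 0\<close> tendsto_imp_eventually_ne by blast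
  have "((\<lambda>r. ((y r - y a) / (r - a)) / g (s r)) \<longlongrightarrow> e / d) (at a)"
    using y lim \<open>d \<noteq> 0\<close> by (intro tendsto_divide) (auto simp: has_field_derivative_iff)
  moreover have "\<forall>\<^sub>F r in at a. ((y r - y a) / (r - a)) / g (s r) = (s r - s a) / (r - a)"
    using nz eq(1)
  proof eventually_elim
    case (elim r)
    have "y r - y a = g (s r) * (s r - s a)"
      using g(1)[of "s r"] elim eq(2) by simp
    then show ?case using elim by simp
  qed
  ultimately have "((\<lambda>r. (s r - s a) / (r - a)) \<longlongrightarrow> e / d) (at a)"
    by (rule Lim_transform_eventually)
  then show ?thesis by (simp add: has_field_derivative_iff)
qed

lemma inv_into_continuous_at:
  fixes f :: "real \<Rightarrow> real"
  assumes "open S" "continuous_on S f" "inj_on f S" "a \<in> S"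
  shows "isCont (inv_into S f) (f a)" "open (f ` S)"
proof -
  show o: "open (f ` S)" using assms by (intro invariance_of_domain)
  have "continuous_on (f ` S) (inv_into S f)"
    using assms by (intro continuous_on_inverse_open) auto
  then show "isCont (inv_into S f) (f a)"
    using o assms(4) continuous_on_eq_continuous_at by blast
qed

lemma inv_into_derivative:
  fixes f :: "real \<Rightarrow> real"
  assumes "open S" "inj_on f S" "a \<in> S"
    and der: "\<And>x. x \<in> S \<Longrightarrow> (f has_real_derivative f' x) (at x)" and "f' a \<noteq> 0"
  shows "(inv_into S f has_real_derivative inverse (f' a)) (at (f a))"
proof -
  have c: "continuous_on S f"
    using der by (meson DERIV_isCont continuous_at_imp_continuous_on)
  note i = inv_into_continuous_at[OF assms(1) c assms(2,3)]
  have [simp]: "inv_into S f (f a) = a" using assms by simp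
  have "(inv_into S f has_real_derivative 1 / f' a) (at (f a))"
  proof (rule reparametrisation_derivative[where y = "\<lambda>y. y"])
    show "(f has_real_derivative f' a) (at (inv_into S f (f a)))" using der assms by simp
    have "\<forall>\<^sub>F y in at (f a). y \<in> f ` S"
      using i(2) assms(3) by (intro eventually_at_in_open') auto
    then show "\<forall>\<^sub>F y in at (f a). f (inv_into S f y) = y"
      by (rule eventually_mono) (simp add: f_inv_into_f)
  qed (use i assms in auto)
  then show ?thesis by (simp add: inverse_eq_divide)
qed

lemma antiderivative_on_open_interval:
  fixes f :: "real \<Rightarrow> real"
  assumes "open I" "is_interval I" "continuous_on I f"
  obtains F where "\<And>x. x \<in> I \<Longrightarrow> (F has_real_derivative f x) (at x)"
proof (cases "I = {}")
  case False
  then obtain c where c: "c \<in> I" by auto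
  define F where "F x = (if c \<le> x then integral {c..x} f else - integral {x..c} f)" for x
  have sub: "{a..b} \<subseteq> I" if "a \<in> I" "b \<in> I" for a b
    using mem_is_interval_1_I[OF assms(2) that] by auto
  have int: "f integrable_on {a..b}" if "a \<in> I" "b \<in> I" for a b
    using sub[OF that] assms(3) by (meson continuous_on_subset integrable_continuous_real)
  have Fdiff: "F y - F a = integral {a..y} f" if "a \<in> I" "y \<in> I" "a \<le> y" for a y
  proof -
    consider "c \<le> a" | "a < c" "c \<le> y" | "y < c" using that by linarith
    then show ?thesis
    proof cases
      case 1
      then show ?thesis using Henstock_Kurzweil_Integration.integral_combine[of c a y f] int[OF c that(2)] that by (auto simp: F_def)
    next
      case 2
      then show ?thesis using Henstock_Kurzweil_Integration.integral_combine[of a c y f] int[OF that(1,2)] that by (auto simp: F_def)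
    next
      case 3
      then show ?thesis using Henstock_Kurzweil_Integration.integral_combine[of a y c f] int[OF that(1) c] that by (auto simp: F_def)
    qed
  qed
  show ?thesis
  proof (rule that)
    fix x assume x: "x \<in> I"
    then obtain e where e: "e > 0" "cball x e \<subseteq> I"
      using assms(1) open_contains_cball by blast
    define a b where "a = x - e" and "b = x + e"
    have ab: "a \<in> I" "b \<in> I" "{a..b} \<subseteq> I" "x \<in> {a<..<b}"
      using e by (auto simp: a_def b_def cball_eq_atLeastAtMost)
    have "((\<lambda>u. integral {a..u} f) has_real_derivative f x) (at x within {a..b})"
      using ab assms(3) by (intro integral_has_real_derivative) (auto intro: continuous_on_subset)
    then have "((\<lambda>u. F a + integral {a..u} f) has_real_derivative f x) (at x within {a..b})"
      by (auto intro!: derivative_eq_intros)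
    then have "(F has_real_derivative f x) (at x within {a..b})"
    proof (rule has_field_derivative_transform_within[where d = e])
      fix u assume "u \<in> {a..b}"
      then have "F u - F a = integral {a..u} f" using ab by (intro Fdiff) auto
      then show "F a + integral {a..u} f = F u" by simp
    qed (use e ab in auto)
    then show "(F has_real_derivative f x) (at x)"
      using ab(4) at_within_Icc_at[of a x b] by auto
  qed
qed auto


section \<open>Complex multiples and the contact structure\<close>

lemma norm_vector_smult: "norm (c *s v) = cmod c * norm (v :: complex ^ 'n)"
  by (simp add: norm_vec_def norm_mult L2_set_right_distrib)

lemma inner_vector_smult:
  "inner (c *s v) (d *s v) = Re (c * cnj d) * (norm (v :: complex ^ 'n))\<^sup>2"
proof -
  have "inner (c *s v) (d *s v) = (\<Sum>j\<in>UNIV. Re (c * cnj d) * inner (v $ j) (v $ j))"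
    unfolding inner_vec_def by (intro sum.cong refl) (simp add: inner_complex_def algebra_simps)
  then show ?thesis
    by (simp add: power2_norm_eq_inner inner_vec_def sum_distrib_left)
qed

text \<open>The real span of \<open>z\<close> and \<open>\<i> z\<close> is the complex line of \<open>z\<close>, so pairing with any complex multiple
  of \<open>z\<close> reduces to pairing with these two vectors.\<close>

lemma inner_vector_smult_left:
  "inner (c *s v) (w :: complex ^ 'n) = Re c * inner v w + Im c * inner (\<i> *s v) w"
  unfolding inner_vec_def sum_distrib_left sum.distrib[symmetric]
  by (intro sum.cong refl) (simp add: inner_complex_def algebra_simps)

lemma inner_i_smult: 
  fixes v w :: "complex ^ 'n"
  shows "inner (\<i> *s v) (\<i> *s w) = inner v w" "inner (\<i> *s v) w = - inner v (\<i> *s w)"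
  unfolding inner_vec_def sum_negf[symmetric]
  by (intro sum.cong refl; simp add: inner_complex_def algebra_simps)+

lemma scaleR_eq_vector_smult: "r *\<^sub>R (v :: complex ^ 'n) = complex_of_real r *s v"
  by (simp add: vec_eq_iff scaleR_conv_of_real[where 'a=complex])

lemma bounded_bilinear_vector_smult:
  "bounded_bilinear ((*s) :: complex \<Rightarrow> complex ^ 'n \<Rightarrow> complex ^ 'n)"
proof (standard)
  show "\<exists>K. \<forall>c (v :: complex ^ 'n). norm (c *s v) \<le> norm c * norm v * K"
    by (rule exI[of _ 1]) (simp add: norm_vector_smult)
qed (auto simp: vec_eq_iff algebra_simps)

text \<open>The contact vector at \<open>p\<close> over a given \<open>z\<close>-component. On contact vectors the complex structure, the
  Levi metric and the frame coordinates see only the \<open>z\<close>-component; all computations below take place there.\<close>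

definition horizontal_lift :: "'n::finite heis \<Rightarrow> complex ^ 'n \<Rightarrow> 'n heis" where
  "horizontal_lift p w = (w, - inner (\<i> *s fst p) w)"

lemma contact_form_eq: "contact_form p V = snd V + inner (\<i> *s fst p) (fst V)"
  unfolding contact_form_def inner_vec_def
  by (simp add: inner_complex_def algebra_simps)

lemma frame_coords_horizontal_lift: "frame_coords p (horizontal_lift p w) = (w, 0)"
  by (simp add: frame_coords_def contact_form_eq horizontal_lift_def)

lemma contact_bundle_iff: "V \<in> contact_bundle p \<longleftrightarrow> V = horizontal_lift p (fst V)"
  by (auto simp: contact_bundle_def contact_form_eq horizontal_lift_def prod_eq_iff)

lemma cstr_eq: "cstr p V = horizontal_lift p (\<i> *s fst V)"
  unfolding cstr_def from_frame_eq horizontal_lift_def frame_coords_def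
  by (simp add: inner_vec_def inner_complex_def algebra_simps)

lemma levi_eq: "levi p V W = inner (fst V) (fst W)"
  by (simp add: levi_def frame_coords_def)

lemma horizontal_lift_linear:
  "- horizontal_lift p w = horizontal_lift p (- w)"
  "horizontal_lift p v + horizontal_lift p w = horizontal_lift p (v + w)"
  "r *\<^sub>R horizontal_lift p w = horizontal_lift p (r *\<^sub>R w)"
  by (simp_all add: horizontal_lift_def inner_add_right)

lemma fst_horizontal_lift [simp]: "fst (horizontal_lift p w) = w"
  by (simp add: horizontal_lift_def)

lemma horizontal_lift_eq_iff [simp]: "horizontal_lift p v = horizontal_lift p w \<longleftrightarrow> v = w"
  by (auto simp: horizontal_lift_def)

section \<open>Speed and phase of a generating curve\<close>

definition contact_speed :: "(real \<Rightarrow> real \<times> real) \<Rightarrow> real \<Rightarrow> real" where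
  "contact_speed \<gamma> s = sqrt ((xcomp \<gamma> s * deriv (xcomp \<gamma>) s)\<^sup>2 + (deriv (tcomp \<gamma>) s)\<^sup>2)"

text \<open>The unit vector along \<open>t' + \<i> x x'\<close>. The hyperplane field \<open>\<xi> \<inter> T\<Sigma>\<close> consists of the horizontal
  lifts of the vectors orthogonal to \<open>phase \<cdot> z\<close>; hence \<open>e\<^sub>2\<^sub>n\<close> is the lift of \<open>phase \<cdot> z / x\<close>, and \<open>l\<close> is governed
  by the rate at which the phase rotates. In terms of its argument \<open>\<psi>\<close>, \<open>cos \<psi> = - x k\<close>
  and \<open>sin \<psi> = x \<alpha>\<close>.\<close>

definition phase :: "(real \<Rightarrow> real \<times> real) \<Rightarrow> real \<Rightarrow> complex" where
  "phase \<gamma> s = Complex (deriv (tcomp \<gamma>) s / contact_speed \<gamma> s)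
                       (xcomp \<gamma> s * deriv (xcomp \<gamma>) s / contact_speed \<gamma> s)"

lemma generating_curveD:
  assumes "generating_curve I \<gamma>" "s \<in> I"
  shows "xcomp \<gamma> s > 0"
    "(xcomp \<gamma> has_real_derivative deriv (xcomp \<gamma>) s) (at s)"
    "(tcomp \<gamma> has_real_derivative deriv (tcomp \<gamma>) s) (at s)"
    "(deriv (xcomp \<gamma>) has_real_derivative deriv (deriv (xcomp \<gamma>)) s) (at s)"
    "(deriv (tcomp \<gamma>) has_real_derivative deriv (deriv (tcomp \<gamma>)) s) (at s)"
    "deriv (xcomp \<gamma>) s \<noteq> 0 \<or> deriv (tcomp \<gamma>) s \<noteq> 0"
    "contact_speed \<gamma> s > 0"
proof -
  have sm: "((deriv ^^ k) (xcomp \<gamma>)) field_differentiable (at s)"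
     "((deriv ^^ k) (tcomp \<gamma>)) field_differentiable (at s)" for k
    using assms by (auto simp: generating_curve_def smooth_curve_on_def)
  show "(xcomp \<gamma> has_real_derivative deriv (xcomp \<gamma>) s) (at s)"
    "(tcomp \<gamma> has_real_derivative deriv (tcomp \<gamma>) s) (at s)"
    using sm[of 0] by (auto intro: field_differentiable_derivI)
  show "(deriv (xcomp \<gamma>) has_real_derivative deriv (deriv (xcomp \<gamma>)) s) (at s)"
    "(deriv (tcomp \<gamma>) has_real_derivative deriv (deriv (tcomp \<gamma>)) s) (at s)"
    using sm[of 1] by (auto intro: field_differentiable_derivI)
  show x: "xcomp \<gamma> s > 0" and r: "deriv (xcomp \<gamma>) s \<noteq> 0 \<or> deriv (tcomp \<gamma>) s \<noteq> 0"
    using assms by (auto simp: generating_curve_def)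
  show "contact_speed \<gamma> s > 0"
    unfolding contact_speed_def using x r
    by (simp add: sum_power2_gt_zero_iff)
qed

lemma contact_speed_sq:
  "(contact_speed \<gamma> s)\<^sup>2 = (xcomp \<gamma> s * deriv (xcomp \<gamma>) s)\<^sup>2 + (deriv (tcomp \<gamma>) s)\<^sup>2"
  unfolding contact_speed_def by simp

lemma cmod_phase:
  assumes "generating_curve I \<gamma>" "s \<in> I"
  shows "cmod (phase \<gamma> s) = 1"
proof -
  have "(deriv (tcomp \<gamma>) s / contact_speed \<gamma> s)\<^sup>2
      + (xcomp \<gamma> s * deriv (xcomp \<gamma>) s / contact_speed \<gamma> s)\<^sup>2 = 1"
    using generating_curveD(7)[OF assms]
    by (simp add: power_divide add_divide_distrib[symmetric] contact_speed_sq[symmetric] add.commute[of "(deriv (tcomp \<gamma>) s)\<^sup>2"])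
  then show ?thesis by (simp add: phase_def cmod_def)
qed

lemma generating_curve_continuous:
  assumes "generating_curve I \<gamma>"
  shows "continuous_on I (xcomp \<gamma>)" "continuous_on I (deriv (tcomp \<gamma>))"
  using generating_curveD(2,5)[OF assms]
  by (meson DERIV_isCont continuous_at_imp_continuous_on)+

section \<open>Tangent spaces of rotationally symmetric hypersurfaces\<close>

context
  fixes I :: "real set" and \<gamma> :: "real \<Rightarrow> real \<times> real"
  assumes gen: "generating_curve I \<gamma>" and inj: "inj_on (xcomp \<gamma>) I"
begin

text \<open>Every curve in the hypersurface carries a differentiable parameter of the generating curve. Continuity
  of the parameter comes from the injectivity of the \<open>x\<close>-component alone, so points with \<open>x' = 0\<close> are
  included; there differentiability is read off the \<open>t\<close>-component.\<close>

lemma curve_parameter: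
  fixes p :: "'n::finite heis"
  assumes s: "s \<in> I" "(norm (fst p), snd p) = \<gamma> s"
    and c: "curve_in (rot_surface I \<gamma>) p v c"
  obtains \<sigma> m where "\<sigma> 0 = s" "(\<sigma> has_real_derivative m) (at 0)"
    "\<forall>\<^sub>F r in at 0. \<sigma> r \<in> I \<and> (norm (fst (c r)), snd (c r)) = \<gamma> (\<sigma> r)"
    "inner (fst p) (fst v) = xcomp \<gamma> s * (deriv (xcomp \<gamma>) s * m)"
    "snd v = deriv (tcomp \<gamma>) s * m"
proof -
  define a where "a r = norm (fst (c r))" for r
  define \<sigma> where "\<sigma> r = inv_into I (xcomp \<gamma>) (a r)" for r
  note d = generating_curveD[OF gen s(1)]
  have xs: "xcomp \<gamma> s = norm (fst p)" and ts: "tcomp \<gamma> s = snd p" using s(2)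
    by (metis fst_conv, metis snd_conv)
  have c0: "c 0 = p" and cv: "(c has_vector_derivative v) (at 0)"
    and cS: "\<forall>\<^sub>F r in at 0. c r \<in> rot_surface I \<gamma>" using c by (auto simp: curve_in_def)
  have nz: "fst p \<noteq> 0" using d(1) xs by auto
  have cfst: "((\<lambda>r. fst (c r)) has_vector_derivative fst v) (at 0)"
    using cv by (auto simp: has_vector_derivative_def intro!: derivative_eq_intros)
  have "((\<lambda>r. snd (c r)) has_vector_derivative snd v) (at 0)"
    using cv by (auto simp: has_vector_derivative_def intro!: derivative_eq_intros)
  then have cb: "((\<lambda>r. snd (c r)) has_real_derivative snd v) (at 0)"
    by (simp add: has_real_derivative_iff_has_vector_derivative)
  have "(norm has_derivative (\<lambda>h. inner h (sgn (fst p)))) (at (fst (c 0)))"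
    using has_derivative_norm[OF nz] c0 by simp
  from has_derivative_compose[OF cfst[unfolded has_vector_derivative_def] this]
  have "(a has_derivative (\<lambda>h. inner (h *\<^sub>R fst v) (sgn (fst p)))) (at 0)"
    unfolding a_def .
  then have ca: "(a has_real_derivative inner (fst p) (fst v) / norm (fst p)) (at 0)"
    by (rule has_derivative_imp_has_field_derivative)
      (simp add: sgn_div_norm inner_commute field_simps)
  have a0: "a 0 = xcomp \<gamma> s" using c0 xs by (simp add: a_def)
  have \<sigma>0: "\<sigma> 0 = s" using a0 inv_into_f_f[OF inj s(1)] by (simp add: \<sigma>_def)
  have "open I" using gen by (simp add: generating_curve_def)
  note ic = inv_into_continuous_at[OF this generating_curve_continuous(1)[OF gen] inj s(1)]
  have \<sigma>c: "isCont \<sigma> 0"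
    unfolding \<sigma>_def using isCont_o2[OF DERIV_isCont[OF ca], of "inv_into I (xcomp \<gamma>)"] ic(1)
    by (simp only: a0)
  have ev: "\<forall>\<^sub>F r in at 0. \<sigma> r \<in> I \<and> (norm (fst (c r)), snd (c r)) = \<gamma> (\<sigma> r)"
    using cS
  proof eventually_elim
    case (elim r)
    then obtain r' where r': "r' \<in> I" "(norm (fst (c r)), snd (c r)) = \<gamma> r'"
      by (auto simp: rot_surface_def)
    then have "a r = xcomp \<gamma> r'" by (metis a_def fst_conv)
    then have "\<sigma> r = r'" using inv_into_f_f[OF inj r'(1)] by (simp add: \<sigma>_def)
    then show ?case using r' by simp
  qed
  have evx: "\<forall>\<^sub>F r in at 0. xcomp \<gamma> (\<sigma> r) = a r"
    and evt: "\<forall>\<^sub>F r in at 0. tcomp \<gamma> (\<sigma> r) = snd (c r)"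
    by (rule eventually_mono[OF ev], metis a_def fst_conv)
      (rule eventually_mono[OF ev], metis snd_conv)
  \<comment> \<open>one of the two components of the regular curve has a nonzero derivative at \<open>s\<close>\<close>
  have "\<exists>m. (\<sigma> has_real_derivative m) (at 0)"
    using d(6)
  proof
    assume "deriv (xcomp \<gamma>) s \<noteq> 0"
    then show ?thesis
      using reparametrisation_derivative[of "xcomp \<gamma>" _ \<sigma> 0 a] d(2) \<sigma>0 \<sigma>c ca evx a0 by auto
  next
    assume "deriv (tcomp \<gamma>) s \<noteq> 0"
    then show ?thesis
      using reparametrisation_derivative[of "tcomp \<gamma>" _ \<sigma> 0 "\<lambda>r. snd (c r)"] d(3) \<sigma>0 \<sigma>c cb evt ts c0
      by auto
  qed
  then obtain m where m: "(\<sigma> has_real_derivative m) (at 0)" ..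
  have "((\<lambda>r. xcomp \<gamma> (\<sigma> r)) has_real_derivative deriv (xcomp \<gamma>) s * m) (at 0)"
    using DERIV_chain2[of "xcomp \<gamma>" _ \<sigma> 0 m] d(2) m \<sigma>0 by simp
  then have "(a has_real_derivative deriv (xcomp \<gamma>) s * m) (at 0)"
    using DERIV_cong_ev[OF refl _ refl, of "\<lambda>r. xcomp \<gamma> (\<sigma> r)" a 0] evx a0 \<sigma>0
    by (simp add: eventually_nhds_conv_at)
  then have "deriv (xcomp \<gamma>) s * m = inner (fst p) (fst v) / norm (fst p)"
    using ca DERIV_unique by blast
  then have 1: "inner (fst p) (fst v) = xcomp \<gamma> s * (deriv (xcomp \<gamma>) s * m)"
    using nz xs by (simp add: field_simps)
  have "((\<lambda>r. tcomp \<gamma> (\<sigma> r)) has_real_derivative deriv (tcomp \<gamma>) s * m) (at 0)"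
    using DERIV_chain2[of "tcomp \<gamma>" _ \<sigma> 0 m] d(3) m \<sigma>0 by simp
  then have "((\<lambda>r. snd (c r)) has_real_derivative deriv (tcomp \<gamma>) s * m) (at 0)"
    using DERIV_cong_ev[OF refl _ refl, of "\<lambda>r. tcomp \<gamma> (\<sigma> r)" "\<lambda>r. snd (c r)" 0] evt ts c0 \<sigma>0
    by (simp add: eventually_nhds_conv_at)
  then have 2: "snd v = deriv (tcomp \<gamma>) s * m"
    using cb DERIV_unique by blast
  show ?thesis by (rule that[OF \<sigma>0 m ev 1 2])
qed

lemma tangent_space_rot_surface:
  fixes p :: "'n::finite heis"
  assumes s: "s \<in> I" "(norm (fst p), snd p) = \<gamma> s"
  shows "tangent_space (rot_surface I \<gamma>) p = {v. deriv (tcomp \<gamma>) s * inner (fst p) (fst v)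
     = xcomp \<gamma> s * deriv (xcomp \<gamma>) s * snd v}" (is "?T = ?R")
proof (intro set_eqI iffI)
  fix v assume "v \<in> ?T"
  then obtain c where "curve_in (rot_surface I \<gamma>) p v c" by (auto simp: tangent_space_def)
  then obtain m where "inner (fst p) (fst v) = xcomp \<gamma> s * (deriv (xcomp \<gamma>) s * m)"
      "snd v = deriv (tcomp \<gamma>) s * m"
    using curve_parameter[OF s] by metis
  then show "v \<in> ?R" by simp
next
  fix v assume v: "v \<in> ?R"
  note d = generating_curveD[OF gen s(1)]
  define z w where "z = fst p" and "w = fst v"
  have xs: "xcomp \<gamma> s = norm z" and ts: "tcomp \<gamma> s = snd p" using s(2)
    by (metis fst_conv z_def, metis snd_conv)
  have nz: "z \<noteq> 0" using d(1) xs by auto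
  obtain m where m: "inner z w = norm z * (deriv (xcomp \<gamma>) s * m)" "snd v = deriv (tcomp \<gamma>) s * m"
  proof (cases "deriv (xcomp \<gamma>) s = 0")
    case True
    then show ?thesis using that[of "snd v / deriv (tcomp \<gamma>) s"] v d(6) by (auto simp: z_def w_def)
  next
    case False
    then show ?thesis using that[of "inner z w / (norm z * deriv (xcomp \<gamma>) s)"] v nz xs
      by (auto simp: z_def[symmetric] w_def[symmetric] field_simps)
  qed
  \<comment> \<open>move with speed \<open>m\<close> along the generating curve, while the direction of \<open>z\<close> follows \<open>z + r w\<close>\<close>
  define c where "c r = ((xcomp \<gamma> (s + m * r) / norm (z + r *\<^sub>R w)) *\<^sub>R (z + r *\<^sub>R w),
     tcomp \<gamma> (s + m * r))" for r :: real
  have "open I" using gen by (simp add: generating_curve_def)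
  have lin: "((\<lambda>r. s + m * r) has_real_derivative m) (at 0)"
    by (auto intro!: derivative_eq_intros)
  have x: "((\<lambda>r. xcomp \<gamma> (s + m * r)) has_real_derivative deriv (xcomp \<gamma>) s * m) (at 0)"
    using DERIV_chain2[of "xcomp \<gamma>" _ _ 0 m, OF _ lin] d(2) by simp
  have t: "((\<lambda>r. tcomp \<gamma> (s + m * r)) has_real_derivative deriv (tcomp \<gamma>) s * m) (at 0)"
    using DERIV_chain2[of "tcomp \<gamma>" _ _ 0 m, OF _ lin] d(3) by simp
  have zw: "((\<lambda>r. z + r *\<^sub>R w) has_vector_derivative w) (at 0)"
    by (auto intro!: derivative_eq_intros)
  have "(norm has_derivative (\<lambda>h. inner h (sgn z))) (at (z + 0 *\<^sub>R w))"
    using has_derivative_norm[OF nz] by simp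
  from has_derivative_compose[OF zw[unfolded has_vector_derivative_def] this]
  have nzw: "((\<lambda>r. norm (z + r *\<^sub>R w)) has_real_derivative inner z w / norm z) (at 0)"
    by (rule has_derivative_imp_has_field_derivative)
      (simp add: sgn_div_norm inner_commute field_simps)
  have q: "((\<lambda>r. xcomp \<gamma> (s + m * r) / norm (z + r *\<^sub>R w)) has_real_derivative 0) (at 0)"
    using DERIV_divide[OF x nzw] nz xs m(1) by simp
  then have "((\<lambda>r. (xcomp \<gamma> (s + m * r) / norm (z + r *\<^sub>R w)) *\<^sub>R (z + r *\<^sub>R w)) has_vector_derivative w) (at 0)"
    using has_vector_derivative_scaleR[OF q zw] nz xs by simp
  moreover have "((\<lambda>r. tcomp \<gamma> (s + m * r)) has_vector_derivative snd v) (at 0)"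
    using t m(2) by (simp add: has_real_derivative_iff_has_vector_derivative)
  ultimately have "(c has_vector_derivative (w, snd v)) (at 0)"
    unfolding c_def by (rule has_vector_derivative_Pair)
  moreover have "c 0 = p" using nz xs ts by (simp add: c_def z_def)
  moreover have "\<forall>\<^sub>F r in at 0. c r \<in> rot_surface I \<gamma>"
  proof -
    have "((\<lambda>r. s + m * r) \<longlongrightarrow> s) (at 0)" using DERIV_isCont[OF lin] by (simp add: isCont_def)
    then have "\<forall>\<^sub>F r in at 0. s + m * r \<in> I"
      using topological_tendstoD \<open>open I\<close> s(1) by blast
    moreover have "((\<lambda>r. norm (z + r *\<^sub>R w)) \<longlongrightarrow> norm z) (at 0)"
      using DERIV_isCont[OF nzw] by (simp add: isCont_def)
    then have "\<forall>\<^sub>F r in at 0. norm (z + r *\<^sub>R w) \<noteq> 0"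
      by (rule tendsto_imp_eventually_ne) (use nz in simp)
    ultimately show ?thesis
    proof eventually_elim
      case (elim r)
      have "xcomp \<gamma> (s + m * r) > 0" using generating_curveD(1)[OF gen] elim by blast
      then show ?case using elim by (auto simp: rot_surface_def c_def prod_eq_iff intro!: bexI[of _ "s + m * r"])
    qed
  qed
  ultimately show "v \<in> ?T" by (auto simp: tangent_space_def curve_in_def w_def)
qed

end


section \<open>The adapted frame and the invariant alpha\<close>

lemma complex_orthogonal_smult:
  fixes z w :: "complex ^ 'n"
  assumes "c \<noteq> 0"
  shows "inner (c *s z) w = 0 \<and> inner ((\<i> * c) *s z) w = 0 \<longleftrightarrow> inner z w = 0 \<and> inner (\<i> *s z) w = 0"
proof -
  have nz: "(Re c)\<^sup>2 + (Im c)\<^sup>2 \<noteq> 0"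
    using assms by (simp add: complex_eq_iff sum_power2_eq_zero_iff)
  define P Q where "P = inner z w" and "Q = inner (\<i> *s z) w"
  have "inner (c *s z) w = Re c * P + Im c * Q" "inner ((\<i> * c) *s z) w = - Im c * P + Re c * Q"
    unfolding P_def Q_def by (subst inner_vector_smult_left; simp)+
  moreover have "((Re c)\<^sup>2 + (Im c)\<^sup>2) * P = Re c * (Re c * P + Im c * Q) - Im c * (- Im c * P + Re c * Q)"
    "((Re c)\<^sup>2 + (Im c)\<^sup>2) * Q = Im c * (Re c * P + Im c * Q) + Re c * (- Im c * P + Re c * Q)"
    by algebra+
  ultimately show ?thesis
    using nz unfolding P_def[symmetric] Q_def[symmetric] by auto
qed

text \<open>For \<open>n \<ge> 2\<close> the space \<open>\<xi>'\<close> is nontrivial; this makes the common eigenvalue \<open>k\<close> unique.\<close>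

lemma exists_complex_orthogonal:
  assumes "CARD('n::finite) \<ge> 2"
  obtains w :: "complex ^ 'n" where "w \<noteq> 0" "inner z w = 0" "inner (\<i> *s z) w = 0"
proof -
  have "dim {z, \<i> *s z} \<le> card {z, \<i> *s z}" by (intro dim_le_card') auto
  also have "\<dots> \<le> 2" by (simp add: card_insert_if)
  also have "2 < DIM(complex ^ 'n)" using assms by simp
  finally obtain w where "w \<noteq> 0" "\<And>y. y \<in> span {z, \<i> *s z} \<Longrightarrow> orthogonal w y"
    using orthogonal_to_subspace_exists by blast
  then have "w \<noteq> 0" "orthogonal w z" "orthogonal w (\<i> *s z)"
    by (auto intro: span_base)
  then show ?thesis using that[of w] by (simp add: orthogonal_def inner_commute)
qed

lemma horizontal_set_eqI:
  assumes "\<And>V. V \<in> A \<Longrightarrow> V = horizontal_lift p (fst V)"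
    and "\<And>w. horizontal_lift p w \<in> A \<longleftrightarrow> P w"
  shows "A = {horizontal_lift p w | w. P w}"
proof (intro set_eqI iffI)
  fix V assume "V \<in> A"
  with assms have "V = horizontal_lift p (fst V) \<and> P (fst V)" by metis
  then show "V \<in> {horizontal_lift p w | w. P w}" by blast
qed (use assms(2) in auto)

context
  fixes I :: "real set" and \<gamma> :: "real \<Rightarrow> real \<times> real" and s :: real
    and p :: "'n::finite heis"
  assumes gen: "generating_curve I \<gamma>" and inj: "inj_on (xcomp \<gamma>) I"
    and sI: "s \<in> I" and ps: "(norm (fst p), snd p) = \<gamma> s"
begin

lemma at_point:
  "xcomp \<gamma> s = norm (fst p)" "tcomp \<gamma> s = snd p" "p \<in> rot_surface I \<gamma>" "fst p \<noteq> 0"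
  using ps sI generating_curveD(1)[OF gen sI]
  by (metis fst_conv, metis snd_conv, auto simp: rot_surface_def, metis fst_conv norm_zero less_irrefl)

lemma phase_nz: "phase \<gamma> s \<noteq> 0"
  using cmod_phase[OF gen sI] by auto

lemma contact_speed_phase:
  "complex_of_real (contact_speed \<gamma> s) * phase \<gamma> s
     = Complex (deriv (tcomp \<gamma>) s) (xcomp \<gamma> s * deriv (xcomp \<gamma>) s)"
  using generating_curveD(7)[OF gen sI]
  by (simp add: phase_def complex_eq_iff)

lemma xi_tangent_rot_surface:
  "xi_tangent (rot_surface I \<gamma>) p = {horizontal_lift p w | w. inner (phase \<gamma> s *s fst p) w = 0}"
proof -
  have D: "contact_speed \<gamma> s > 0" by (rule generating_curveD(7)[OF gen sI])
  have "inner (phase \<gamma> s *s fst p) w = 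
     (deriv (tcomp \<gamma>) s * inner (fst p) w + xcomp \<gamma> s * deriv (xcomp \<gamma>) s * inner (\<i> *s fst p) w)
      / contact_speed \<gamma> s" for w
    by (subst inner_vector_smult_left) (simp add: phase_def add_divide_distrib)
  then have "horizontal_lift p w \<in> tangent_space (rot_surface I \<gamma>) p
     \<longleftrightarrow> inner (phase \<gamma> s *s fst p) w = 0" for w
    using D by (auto simp: tangent_space_rot_surface[OF gen inj sI ps] horizontal_lift_def)
  then have "horizontal_lift p w \<in> xi_tangent (rot_surface I \<gamma>) p
      \<longleftrightarrow> inner (phase \<gamma> s *s fst p) w = 0" for w
    unfolding xi_tangent_def Int_iff contact_bundle_iff by simp
  moreover have "V = horizontal_lift p (fst V)" if "V \<in> xi_tangent (rot_surface I \<gamma>) p" for V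
    using that unfolding xi_tangent_def contact_bundle_iff Int_iff by blast
  ultimately show ?thesis by (rule horizontal_set_eqI[rotated])
qed

text \<open>Rotating by \<open>\<i>\<close> turns the condition \<open>w \<bottom> phase \<cdot> z\<close> into \<open>w \<bottom> \<i> phase \<cdot> z\<close>, and both
  together say that \<open>w\<close> is orthogonal to the whole complex line of \<open>z\<close>.\<close>

lemma xi_prime_rot_surface:
  "xi_prime (rot_surface I \<gamma>) p
     = {horizontal_lift p w | w. inner (fst p) w = 0 \<and> inner (\<i> *s fst p) w = 0}"
proof -
  have rot: "inner v (- (\<i> *s w)) = inner (\<i> *s v) w" for v w :: "complex ^ 'n"
    by (simp add: inner_i_smult(2))
  have "horizontal_lift p w \<in> cstr p ` xi_tangent (rot_surface I \<gamma>) p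
       \<longleftrightarrow> inner ((\<i> * phase \<gamma> s) *s fst p) w = 0" for w
  proof
    assume "horizontal_lift p w \<in> cstr p ` xi_tangent (rot_surface I \<gamma>) p"
    then obtain w' where "w = \<i> *s w'" "inner (phase \<gamma> s *s fst p) w' = 0"
      by (auto simp: xi_tangent_rot_surface cstr_eq)
    then show "inner ((\<i> * phase \<gamma> s) *s fst p) w = 0"
      by (simp only: vector_smult_assoc[symmetric] inner_i_smult(1))
  next
    assume "inner ((\<i> * phase \<gamma> s) *s fst p) w = 0"
    then have "inner (phase \<gamma> s *s fst p) (- (\<i> *s w)) = 0"
      unfolding rot by simp
    moreover have "horizontal_lift p w = cstr p (horizontal_lift p (- (\<i> *s w)))"
      by (simp add: cstr_eq vec_eq_iff)
    ultimately show "horizontal_lift p w \<in> cstr p ` xi_tangent (rot_surface I \<gamma>) p"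
      unfolding xi_tangent_rot_surface by (intro image_eqI[of _ _ "horizontal_lift p (- (\<i> *s w))"]) auto
  qed
  then have "horizontal_lift p w \<in> xi_prime (rot_surface I \<gamma>) p \<longleftrightarrow>
      inner (fst p) w = 0 \<and> inner (\<i> *s fst p) w = 0" for w
    unfolding xi_prime_def complex_orthogonal_smult[OF phase_nz, symmetric]
    by (auto simp: xi_tangent_rot_surface)
  moreover have "V = horizontal_lift p (fst V)" if "V \<in> xi_prime (rot_surface I \<gamma>) p" for V
    using that unfolding xi_prime_def xi_tangent_def contact_bundle_iff Int_iff by blast
  ultimately show ?thesis by (rule horizontal_set_eqI[rotated])
qed

text \<open>The choice of \<open>\<theta>\<close> and \<open>u\<close> drops out, because \<open>\<theta>'\<close> is prescribed and the
  injectivity of the \<open>x\<close>-component fixes the parameter of the point.\<close>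

lemma horizontal_velocity_eq:
  assumes "horizontal_velocity I \<gamma> p g"
  shows "fst g = (- \<i> * (complex_of_real (contact_speed \<gamma> s / (xcomp \<gamma> s)\<^sup>2) * phase \<gamma> s)) *s fst p"
proof -
  obtain \<theta> u s' where h: "s' \<in> I" "norm u = 1"
    "\<And>r. r \<in> I \<Longrightarrow> (\<theta> has_real_derivative - deriv (tcomp \<gamma>) r / (xcomp \<gamma> r)\<^sup>2) (at r)"
    "horizontal_curve \<gamma> \<theta> u s' = p"
    "(horizontal_curve \<gamma> \<theta> u has_vector_derivative g) (at s')"
    using assms unfolding horizontal_velocity_def by (elim exE bexE conjE) (rule that; simp)
  have "norm (fst p) = xcomp \<gamma> s'"
    using h(2) h(4)[symmetric] generating_curveD(1)[OF gen h(1)]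
    by (simp add: horizontal_curve_def norm_vector_smult norm_mult)
  then have [simp]: "s' = s" using inj_onD[OF inj _ h(1) sI] at_point(1) by simp
  note d = generating_curveD[OF gen sI]
  define f where "f r = complex_of_real (xcomp \<gamma> r) * cis (\<theta> r)" for r
  define x where "x = xcomp \<gamma> s"
  have x: "x > 0" using d(1) by (simp add: x_def)
  define q where "q = complex_of_real (deriv (xcomp \<gamma>) s) - \<i> * of_real (deriv (tcomp \<gamma>) s / x)"
  have "((\<lambda>r. of_real (xcomp \<gamma> r) :: complex) has_vector_derivative of_real (deriv (xcomp \<gamma>) s)) (at s)"
    using d(2) by (simp add: has_vector_derivative_of_real)
  moreover have "((\<lambda>r. cis (\<theta> r)) has_vector_derivative of_real (- deriv (tcomp \<gamma>) s / x\<^sup>2) * (\<i> * cis (\<theta> s))) (at s)"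
    using has_derivative_cis[OF h(3)[OF sI, unfolded has_field_derivative_def]]
    by (simp add: has_vector_derivative_def x_def[symmetric] scaleR_conv_of_real mult_ac)
  ultimately have "(f has_vector_derivative q * cis (\<theta> s)) (at s)"
    unfolding f_def
  proof (rule has_vector_derivative_eq_rhs[OF has_vector_derivative_mult])
    show "complex_of_real (xcomp \<gamma> s) * (of_real (- deriv (tcomp \<gamma>) s / x\<^sup>2) * (\<i> * cis (\<theta> s)))
        + complex_of_real (deriv (xcomp \<gamma>) s) * cis (\<theta> s) = q * cis (\<theta> s)"
      using x by (simp add: q_def x_def[symmetric] power2_eq_square) (simp add: field_simps)
  qed
  from bounded_bilinear.has_vector_derivative[OF bounded_bilinear_vector_smult this, of "\<lambda>_. u" 0]
  have "((\<lambda>r. f r *s u) has_vector_derivative (q * cis (\<theta> s)) *s u) (at s)" by simp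
  moreover have "((\<lambda>r. fst (horizontal_curve \<gamma> \<theta> u r)) has_vector_derivative fst g) (at s)"
    using h(5) by (auto simp: has_vector_derivative_def intro!: derivative_eq_intros)
  ultimately have "fst g = (q * cis (\<theta> s)) *s u"
    by (simp add: horizontal_curve_def f_def vector_derivative_unique_at)
  also have "\<dots> = (q / of_real x) *s fst p"
    using h(4)[symmetric] x by (simp add: horizontal_curve_def x_def[symmetric])
  also have "q / of_real x = - \<i> * (complex_of_real (contact_speed \<gamma> s / (xcomp \<gamma> s)\<^sup>2) * phase \<gamma> s)"
    using contact_speed_phase x unfolding x_def[symmetric] q_def
    by (simp add: complex_eq_iff field_simps power2_eq_square)
  finally show ?thesis .
qed

lemma horizontal_velocity_exists: "\<exists>g. horizontal_velocity I \<gamma> p g"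
proof -
  note d = generating_curveD[OF gen]
  have I: "open I" "is_interval I" using gen by (auto simp: generating_curve_def)
  have "continuous_on I (\<lambda>r. - deriv (tcomp \<gamma>) r / (xcomp \<gamma> r)\<^sup>2)"
    using d(1) by (intro continuous_intros generating_curve_continuous[OF gen]) force
  then obtain \<Theta> where
    "\<And>r. r \<in> I \<Longrightarrow> (\<Theta> has_real_derivative - deriv (tcomp \<gamma>) r / (xcomp \<gamma> r)\<^sup>2) (at r)"
    by (rule antiderivative_on_open_interval[OF I]) (rule that)
  then have \<Theta>: "((\<lambda>r. \<Theta> r - \<Theta> s) has_real_derivative - deriv (tcomp \<gamma>) r / (xcomp \<gamma> r)\<^sup>2) (at r)"
    if "r \<in> I" for r
    using that by (auto intro!: derivative_eq_intros)
  define u where "u = complex_of_real (1 / xcomp \<gamma> s) *s fst p"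
  define h where "h = horizontal_curve \<gamma> (\<lambda>r. \<Theta> r - \<Theta> s) u"
  have "xcomp \<gamma> s > 0" by (rule d(1)[OF sI])
  then have "norm u = 1" "h s = p"
    using at_point by (auto simp: u_def h_def norm_vector_smult horizontal_curve_def prod_eq_iff norm_divide)
  moreover obtain g where "(h has_vector_derivative g) (at s)"
  proof -
    have "((\<lambda>r. complex_of_real (xcomp \<gamma> r)) has_vector_derivative of_real (deriv (xcomp \<gamma>) s)) (at s)"
      using d(2)[OF sI] by (rule has_vector_derivative_of_real)
    moreover obtain g1 where "((\<lambda>r. cis (\<Theta> r - \<Theta> s)) has_vector_derivative g1) (at s)"
      using has_derivative_cis[OF \<Theta>[OF sI, unfolded has_field_derivative_def]]
      by (meson differentiableI vector_derivative_works)
    ultimately obtain g2 where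
      "((\<lambda>r. complex_of_real (xcomp \<gamma> r) * cis (\<Theta> r - \<Theta> s)) has_vector_derivative g2) (at s)"
      using has_vector_derivative_mult by blast
    from bounded_bilinear.has_vector_derivative[OF bounded_bilinear_vector_smult this, of "\<lambda>_. u" 0]
    have "((\<lambda>r. (complex_of_real (xcomp \<gamma> r) * cis (\<Theta> r - \<Theta> s)) *s u) has_vector_derivative g2 *s u) (at s)"
      by simp
    moreover have "(tcomp \<gamma> has_vector_derivative deriv (tcomp \<gamma>) s) (at s)"
      using d(3)[OF sI] by (simp add: has_real_derivative_iff_has_vector_derivative)
    ultimately have "(h has_vector_derivative (g2 *s u, deriv (tcomp \<gamma>) s)) (at s)"
      unfolding h_def horizontal_curve_def by (rule has_vector_derivative_Pair)
    then show ?thesis by (rule that)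
  qed
  ultimately show ?thesis
    unfolding horizontal_velocity_def h_def using \<Theta> sI by blast
qed

text \<open>The factor \<open>- \<i>\<close> is the orientation: the horizontal velocity is a positive multiple of
  \<open>- \<i> \<cdot> phase \<cdot> z\<close>.\<close>

lemma e_n_eq: "e_n I \<gamma> p = horizontal_lift p ((- \<i> * phase \<gamma> s / of_real (xcomp \<gamma> s)) *s fst p)"
proof -
  define x where "x = xcomp \<gamma> s"
  have x: "x > 0" "norm (fst p) = x" using generating_curveD(1)[OF gen sI] at_point by (auto simp: x_def)
  have D: "contact_speed \<gamma> s > 0" by (rule generating_curveD(7)[OF gen sI])
  define c where "c = - \<i> * phase \<gamma> s / of_real x"
  have phi: "phase \<gamma> s * cnj (phase \<gamma> s) = 1"
    using cmod_phase[OF gen sI] by (simp add: complex_norm_square[symmetric])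
  have cnz: "c \<noteq> 0" and cc: "c * cnj c = of_real (1 / x\<^sup>2)" and cp: "Re (phase \<gamma> s * cnj c) = 0"
    using phase_nz x phi by (auto simp: c_def power2_eq_square mult_ac)
  define \<epsilon> where "\<epsilon> = c *s fst p"
  have \<epsilon>: "inner \<epsilon> \<epsilon> = 1" "inner (phase \<gamma> s *s fst p) \<epsilon> = 0"
    unfolding \<epsilon>_def inner_vector_smult x(2) cc cp using x(1) by simp_all
  have pos: "\<exists>r>0. fst g = r *\<^sub>R \<epsilon>" if "horizontal_velocity I \<gamma> p g" for g
    unfolding horizontal_velocity_eq[OF that] scaleR_eq_vector_smult \<epsilon>_def c_def x_def[symmetric]
    using x D by (intro exI[of _ "contact_speed \<gamma> s / x"]) (simp add: power2_eq_square)
  show ?thesis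
    unfolding e_n_def x_def[symmetric] c_def[symmetric] \<epsilon>_def[symmetric]
  proof (rule the_equality, intro conjI ballI)
    show "horizontal_lift p \<epsilon> \<in> xi_tangent (rot_surface I \<gamma>) p"
      using \<epsilon> by (auto simp: xi_tangent_rot_surface)
    show "levi p (horizontal_lift p \<epsilon>) (horizontal_lift p \<epsilon>) = 1"
      using \<epsilon> by (simp add: levi_eq)
    show "levi p (horizontal_lift p \<epsilon>) w = 0" if "w \<in> xi_prime (rot_surface I \<gamma>) p" for w
    proof -
      have "inner (fst p) (fst w) = 0 \<and> inner (\<i> *s fst p) (fst w) = 0"
        using that by (auto simp: xi_prime_rot_surface)
      then show ?thesis
        using complex_orthogonal_smult[OF cnz, of "fst p" "fst w"] by (simp add: levi_eq \<epsilon>_def)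
    qed
    obtain g where g: "horizontal_velocity I \<gamma> p g" using horizontal_velocity_exists by blast
    then show "\<exists>g. horizontal_velocity I \<gamma> p g \<and> levi p (horizontal_lift p \<epsilon>) g > 0"
      using pos[OF g] \<epsilon> by (intro exI[of _ g]) (auto simp: levi_eq)
  next
    fix v
    assume v: "v \<in> xi_tangent (rot_surface I \<gamma>) p \<and> levi p v v = 1 \<and>
     (\<forall>w\<in>xi_prime (rot_surface I \<gamma>) p. levi p v w = 0) \<and>
     (\<exists>g. horizontal_velocity I \<gamma> p g \<and> levi p v g > 0)"
    then obtain w where w: "v = horizontal_lift p w" "inner (phase \<gamma> s *s fst p) w = 0"
      by (auto simp: xi_tangent_rot_surface)
    have ww: "inner w w = 1" using v w by (simp add: levi_eq)
    define w' where "w' = w - inner w \<epsilon> *\<^sub>R \<epsilon>"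
    \<comment> \<open>subtracting the \<open>\<epsilon>\<close>-component leaves a vector of \<open>\<xi>'\<close>, to which \<open>w\<close> is orthogonal\<close>
    have 1: "inner (phase \<gamma> s *s fst p) w' = 0"
      using w \<epsilon> by (simp add: w'_def inner_diff_right)
    have "inner \<epsilon> w' = 0"
      using \<epsilon> by (simp add: w'_def inner_diff_right inner_commute)
    moreover have "(\<i> * phase \<gamma> s) *s fst p = (- x) *\<^sub>R \<epsilon>"
      using x by (simp add: \<epsilon>_def c_def scaleR_eq_vector_smult)
    ultimately have "inner ((\<i> * phase \<gamma> s) *s fst p) w' = 0" by simp
    with 1 have "horizontal_lift p w' \<in> xi_prime (rot_surface I \<gamma>) p"
      unfolding xi_prime_rot_surface using complex_orthogonal_smult[OF phase_nz] by blast
    then have "inner w w' = 0" using v w by (auto simp: levi_eq)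
    then have "inner w' w' = 0"
      using \<open>inner \<epsilon> w' = 0\<close> by (simp add: w'_def inner_diff_left)
    then have w_eq: "w = inner w \<epsilon> *\<^sub>R \<epsilon>" by (simp add: w'_def)
    then have "(inner w \<epsilon>)\<^sup>2 = 1"
      using ww \<epsilon> by (metis inner_scaleR_left inner_scaleR_right mult.right_neutral power2_eq_square)
    moreover obtain g r where "r > 0" "fst g = r *\<^sub>R \<epsilon>" "levi p v g > 0"
      using v pos by blast
    then have "inner w \<epsilon> > 0" using w by (simp add: levi_eq zero_less_mult_iff)
    ultimately have "inner w \<epsilon> = 1" by (simp add: power2_eq_1_iff)
    then show "v = horizontal_lift p \<epsilon>" using w w_eq by simp
  qed
qed

lemma e_2n_eq: "e_2n I \<gamma> p = horizontal_lift p ((phase \<gamma> s / of_real (xcomp \<gamma> s)) *s fst p)"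
  by (simp add: e_2n_def cstr_eq e_n_eq)

text \<open>The vector \<open>\<alpha> e\<^sub>2\<^sub>n + T\<close> lies in the tangent hyperplane iff \<open>\<alpha> \<cdot> |N| = x x'\<close>, where
  \<open>N = (t' + \<i> x x') z\<close> represents the restriction of its conormal to \<open>\<xi>\<close> and has length \<open>x D\<close>,
  \<open>D\<close> being the contact speed.\<close>

lemma inv_alpha_eq: "inv_alpha I \<gamma> p = deriv (xcomp \<gamma>) s / contact_speed \<gamma> s"
proof -
  define x x' t' D where defs: "x = xcomp \<gamma> s" "x' = deriv (xcomp \<gamma>) s" "t' = deriv (tcomp \<gamma>) s"
    "D = contact_speed \<gamma> s"
  have x: "x > 0" "norm (fst p) = x" using generating_curveD(1)[OF gen sI] at_point by (auto simp: defs)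
  have D: "D > 0" unfolding defs by (rule generating_curveD(7)[OF gen sI])
  have D2: "D\<^sup>2 = (x * x')\<^sup>2 + t'\<^sup>2" unfolding defs by (rule contact_speed_sq)
  have 1: "inner (fst p) ((phase \<gamma> s / of_real x) *s fst p) = x * t' / D"
    using inner_vector_smult[of 1 "fst p" "phase \<gamma> s / of_real x"] x
    by (simp add: phase_def defs[symmetric] power2_eq_square field_simps)
  have 2: "inner (\<i> *s fst p) ((phase \<gamma> s / of_real x) *s fst p) = x\<^sup>2 * x' / D"
    using inner_vector_smult[of \<i> "fst p" "phase \<gamma> s / of_real x"] x
    by (simp add: phase_def defs[symmetric] power2_eq_square field_simps)
  have "a *\<^sub>R e_2n I \<gamma> p + reeb \<in> tangent_space (rot_surface I \<gamma>) p \<longleftrightarrow> a = x' / D" for a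
  proof -
    have "a *\<^sub>R e_2n I \<gamma> p + reeb \<in> tangent_space (rot_surface I \<gamma>) p \<longleftrightarrow>
       t' * (a * (x * t' / D)) = x * x' * (1 - a * (x\<^sup>2 * x' / D))"
      unfolding tangent_space_rot_surface[OF gen inj sI ps] e_2n_eq mem_Collect_eq
      by (simp add: horizontal_lift_def reeb_def defs(1)[symmetric] 1 2) (simp add: defs)
    also have "\<dots> \<longleftrightarrow> t' * (a * (x * t' / D)) * D = x * x' * (1 - a * (x\<^sup>2 * x' / D)) * D"
      by (rule mult_right_cancel[symmetric]) (use D in simp)
    also have "\<dots> \<longleftrightarrow> a * (x * ((x * x')\<^sup>2 + t'\<^sup>2)) = x * x' * D"
    proof -
      have "t' * (a * (x * t' / D)) * D = a * x * t'\<^sup>2"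
        using D by (simp add: power2_eq_square)
      moreover have "x * x' * (1 - a * (x\<^sup>2 * x' / D)) * D = x * x' * D - a * x * (x * x')\<^sup>2"
        using D by (simp add: power2_eq_square right_diff_distrib left_diff_distrib mult_ac)
      ultimately show ?thesis by (auto simp: algebra_simps)
    qed
    also have "\<dots> \<longleftrightarrow> a = x' / D"
      unfolding D2[symmetric] using D x by (simp add: field_simps power2_eq_square)
    finally show ?thesis .
  qed
  then show ?thesis unfolding inv_alpha_def defs by (intro the_equality) auto
qed

end


section \<open>The invariants k and l\<close>

lemma frame_coords_inject: "frame_coords p V = frame_coords p W \<longleftrightarrow> V = W"
  by (metis from_frame_frame_coords)

lemma has_vector_derivative_eventually_eq:
  assumes "\<forall>\<^sub>F r in nhds a. f r = g r" "(f has_vector_derivative d) (at a)"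
  shows "(g has_vector_derivative d) (at a)"
proof -
  have "\<forall>\<^sub>F r in nhds a. r \<in> UNIV \<longrightarrow> f r = g r" using assms(1) by simp
  from has_vector_derivative_cong_ev[OF this eventually_nhds_x_imp_x[OF assms(1)]] assms(2)
  show ?thesis by simp
qed

context
  fixes I :: "real set" and \<gamma> :: "real \<Rightarrow> real \<times> real" and s :: real
    and p :: "'n::finite heis"
  assumes gen: "generating_curve I \<gamma>" and inj: "inj_on (xcomp \<gamma>) I"
    and sI: "s \<in> I" and ps: "(norm (fst p), snd p) = \<gamma> s"
begin

text \<open>Along a curve in the hypersurface the frame coefficients of \<open>e\<^sub>2\<^sub>n\<close> are \<open>(phase / x) z\<close> with the factor
  evaluated at the parameter of the curve, so the product rule gives the covariant derivative. Tangency of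
  \<open>v\<close> supplies a curve and thereby uniqueness of \<open>D\<close>.\<close>

lemma nabla_e_2n_iff:
  assumes v: "v \<in> tangent_space (rot_surface I \<gamma>) p"
    and m: "inner (fst p) (fst v) = xcomp \<gamma> s * (deriv (xcomp \<gamma>) s * m)"
      "snd v = deriv (tcomp \<gamma>) s * m"
    and d: "((\<lambda>r. phase \<gamma> r / of_real (xcomp \<gamma> r)) has_vector_derivative d) (at s)"
  shows "has_nabla (rot_surface I \<gamma>) (e_2n I \<gamma>) p v D \<longleftrightarrow>
     D = horizontal_lift p ((of_real m * d) *s fst p + (phase \<gamma> s / of_real (xcomp \<gamma> s)) *s fst v)"
    (is "_ \<longleftrightarrow> D = ?D")
proof -
  have der: "((\<lambda>r. frame_coords (c r) (e_2n I \<gamma> (c r))) has_vector_derivative frame_coords p ?D) (at 0)"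
    if c: "curve_in (rot_surface I \<gamma>) p v c" for c
  proof -
    obtain \<sigma> m' where \<sigma>: "\<sigma> 0 = s" "(\<sigma> has_real_derivative m') (at 0)"
      "\<forall>\<^sub>F r in at 0. \<sigma> r \<in> I \<and> (norm (fst (c r)), snd (c r)) = \<gamma> (\<sigma> r)"
      "inner (fst p) (fst v) = xcomp \<gamma> s * (deriv (xcomp \<gamma>) s * m')"
      "snd v = deriv (tcomp \<gamma>) s * m'"
      by (rule curve_parameter[OF gen inj sI ps c])
    have [simp]: "m' = m"
      using m \<sigma>(4,5) generating_curveD(1,6)[OF gen sI] by auto
    define \<phi> where "\<phi> r = phase \<gamma> r / complex_of_real (xcomp \<gamma> r)" for r
    have cv: "c 0 = p" "(c has_vector_derivative v) (at 0)" using c by (auto simp: curve_in_def)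
    have "((\<phi> \<circ> \<sigma>) has_vector_derivative m *\<^sub>R d) (at 0)"
      using d \<sigma>(1,2) by (intro vector_diff_chain_at)
        (auto simp: \<phi>_def[abs_def] has_real_derivative_iff_has_vector_derivative)
    moreover have "((\<lambda>r. fst (c r)) has_vector_derivative fst v) (at 0)"
      using cv by (auto simp: has_vector_derivative_def intro!: derivative_eq_intros)
    ultimately have "((\<lambda>r. (\<phi> \<circ> \<sigma>) r *s fst (c r)) has_vector_derivative
        (\<phi> \<circ> \<sigma>) 0 *s fst v + (m *\<^sub>R d) *s fst (c 0)) (at 0)"
      by (rule bounded_bilinear.has_vector_derivative[OF bounded_bilinear_vector_smult])
    then have "((\<lambda>r. (\<phi> (\<sigma> r) *s fst (c r), 0::real)) has_vector_derivative
        (\<phi> s *s fst v + (m *\<^sub>R d) *s fst p, 0)) (at 0)"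
      using \<sigma>(1) cv(1) by (intro has_vector_derivative_Pair) auto
    also have "(\<phi> s *s fst v + (m *\<^sub>R d) *s fst p, 0::real) = frame_coords p ?D"
      by (simp add: frame_coords_horizontal_lift \<phi>_def scaleR_conv_of_real add.commute)
    finally have 1: "((\<lambda>r. (\<phi> (\<sigma> r) *s fst (c r), 0::real)) has_vector_derivative frame_coords p ?D) (at 0)" .
    have eq: "frame_coords q (e_2n I \<gamma> q) = (\<phi> r *s fst q, 0)"
      if "r \<in> I" "(norm (fst q), snd q) = \<gamma> r" for q :: "'n heis" and r
      unfolding e_2n_eq[OF gen inj that] frame_coords_horizontal_lift \<phi>_def ..
    have ev: "\<forall>\<^sub>F r in nhds 0. (\<phi> (\<sigma> r) *s fst (c r), 0::real) = frame_coords (c r) (e_2n I \<gamma> (c r))"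
      unfolding eventually_nhds_conv_at
    proof
      show "\<forall>\<^sub>F r in at 0. (\<phi> (\<sigma> r) *s fst (c r), 0::real) = frame_coords (c r) (e_2n I \<gamma> (c r))"
        using \<sigma>(3) by eventually_elim (metis eq)
      show "(\<phi> (\<sigma> 0) *s fst (c 0), 0::real) = frame_coords (c 0) (e_2n I \<gamma> (c 0))"
        using eq[OF sI ps] \<sigma>(1) cv(1) by simp
    qed
    show ?thesis
      by (rule has_vector_derivative_eventually_eq[OF ev 1])
  qed
  show ?thesis
  proof
    assume n: "has_nabla (rot_surface I \<gamma>) (e_2n I \<gamma>) p v D"
    obtain c where c: "curve_in (rot_surface I \<gamma>) p v c" using v by (auto simp: tangent_space_def)
    then have "frame_coords p D = frame_coords p ?D"
      using n der[OF c] unfolding has_nabla_def by (blast intro: vector_derivative_unique_at)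
    then show "D = ?D" by (simp only: frame_coords_inject)
  next
    assume "D = ?D" then show "has_nabla (rot_surface I \<gamma>) (e_2n I \<gamma>) p v D"
      unfolding has_nabla_def using der by blast
  qed
qed

lemma phase_differentiable:
  obtains d where "((\<lambda>r. phase \<gamma> r) has_vector_derivative d) (at s)"
proof -
  note d = generating_curveD[OF gen sI]
  have D2: "((\<lambda>r. (xcomp \<gamma> r * deriv (xcomp \<gamma>) r)\<^sup>2 + (deriv (tcomp \<gamma>) r)\<^sup>2) has_real_derivative
     2 * (xcomp \<gamma> s * deriv (xcomp \<gamma>) s) * (deriv (xcomp \<gamma>) s * deriv (xcomp \<gamma>) s + deriv (deriv (xcomp \<gamma>)) s * xcomp \<gamma> s)
     + 2 * deriv (tcomp \<gamma>) s * deriv (deriv (tcomp \<gamma>)) s) (at s)"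
    using d by (auto intro!: derivative_eq_intros)
  have "(xcomp \<gamma> s * deriv (xcomp \<gamma>) s)\<^sup>2 + (deriv (tcomp \<gamma>) s)\<^sup>2 > 0"
    unfolding contact_speed_sq[symmetric] using d(7) by simp
  note sq = DERIV_chain2[OF DERIV_real_sqrt, OF this D2]
  obtain D' where D': "(contact_speed \<gamma> has_real_derivative D') (at s)"
    unfolding contact_speed_def[abs_def] using sq by blast
  have nz: "contact_speed \<gamma> s \<noteq> 0" using d(7) by simp
  obtain a where "((\<lambda>r. deriv (tcomp \<gamma>) r / contact_speed \<gamma> r) has_real_derivative a) (at s)"
    using DERIV_divide[OF d(5) D' nz] by blast
  moreover obtain b where "((\<lambda>r. xcomp \<gamma> r * deriv (xcomp \<gamma>) r / contact_speed \<gamma> r) has_real_derivative b) (at s)"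
    using DERIV_divide[OF DERIV_mult[OF d(2,4)] D' nz] by blast
  ultimately have "((\<lambda>r. of_real (deriv (tcomp \<gamma>) r / contact_speed \<gamma> r) +
      of_real (xcomp \<gamma> r * deriv (xcomp \<gamma>) r / contact_speed \<gamma> r) * \<i>) has_vector_derivative
      of_real a + of_real b * \<i>) (at s)"
    by (intro has_vector_derivative_add has_vector_derivative_mult_left has_vector_derivative_of_real)
  then show ?thesis
    using that[of "of_real a + of_real b * \<i>"] unfolding phase_def[abs_def] Complex_eq by (simp add: mult.commute)
qed

lemma phase_over_x_derivative:
  assumes "((\<lambda>r. phase \<gamma> r) has_vector_derivative d) (at s)"
  shows "((\<lambda>r. phase \<gamma> r / of_real (xcomp \<gamma> r)) has_vector_derivative
     d / of_real (xcomp \<gamma> s) - phase \<gamma> s * of_real (deriv (xcomp \<gamma>) s / (xcomp \<gamma> s)\<^sup>2)) (at s)"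
proof -
  note g = generating_curveD[OF gen sI]
  have "((\<lambda>r. inverse (xcomp \<gamma> r)) has_real_derivative - (deriv (xcomp \<gamma>) s / (xcomp \<gamma> s)\<^sup>2)) (at s)"
    using DERIV_inverse_fun[OF g(2)] g(1) by (simp add: power2_eq_square divide_inverse mult_ac)
  from has_vector_derivative_mult[OF assms has_vector_derivative_of_real[OF this]]
  show ?thesis by (simp add: divide_inverse mult_ac)
qed

text \<open>A vector of \<open>\<xi>'\<close> does not move the parameter (\<open>m = 0\<close>), so the shape operator multiplies it by
  \<open>- phase / x\<close>; the term \<open>\<alpha> J v\<close> cancels the imaginary part of this factor.\<close>

lemma inv_k_eq:
  "inv_k I \<gamma> p = - deriv (tcomp \<gamma>) s / (xcomp \<gamma> s * contact_speed \<gamma> s)"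
proof (cases "CARD('n) \<ge> 2")
  case False
  have "s' = s" if "s' \<in> I" "(norm (fst p), snd p) = \<gamma> s'" for s'
    using inj_onD[OF inj _ that(1) sI] that(2) ps by simp
  then have "(\<exists>s\<in>I. (norm (fst p), snd p) = \<gamma> s \<and> k = - deriv (tcomp \<gamma>) s /
      (xcomp \<gamma> s * sqrt ((xcomp \<gamma> s * deriv (xcomp \<gamma>) s)\<^sup>2 + (deriv (tcomp \<gamma>) s)\<^sup>2)))
     \<longleftrightarrow> k = - deriv (tcomp \<gamma>) s / (xcomp \<gamma> s * contact_speed \<gamma> s)" for k
    using sI ps unfolding contact_speed_def by metis
  then show ?thesis using False by (simp add: inv_k_def)
next
  case True
  obtain d where "((\<lambda>r. phase \<gamma> r) has_vector_derivative d) (at s)"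
    by (rule phase_differentiable)
  note d = phase_over_x_derivative[OF this]
  let ?k = "- deriv (tcomp \<gamma>) s / (xcomp \<gamma> s * contact_speed \<gamma> s)"
  have coeff: "- (phase \<gamma> s / of_real (xcomp \<gamma> s)) + of_real (inv_alpha I \<gamma> p) * \<i> = of_real ?k"
    using generating_curveD(1,7)[OF gen sI] inv_alpha_eq[OF gen inj sI ps]
    by (simp add: phase_def complex_eq_iff)
  have iff: "(\<exists>D. has_nabla (rot_surface I \<gamma>) (e_2n I \<gamma>) p v D \<and>
      - D + inv_alpha I \<gamma> p *\<^sub>R cstr p v = k *\<^sub>R v) \<longleftrightarrow> ?k *\<^sub>R v = k *\<^sub>R v"
    if v: "v \<in> xi_prime (rot_surface I \<gamma>) p" for v k
  proof -
    have tan: "v \<in> tangent_space (rot_surface I \<gamma>) p"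
      using v by (auto simp: xi_prime_def xi_tangent_def)
    obtain w where w: "v = horizontal_lift p w" "inner (fst p) w = 0" "inner (\<i> *s fst p) w = 0"
      using v by (auto simp: xi_prime_rot_surface[OF gen inj sI ps])
    have "has_nabla (rot_surface I \<gamma>) (e_2n I \<gamma>) p v D \<longleftrightarrow>
       D = horizontal_lift p ((phase \<gamma> s / of_real (xcomp \<gamma> s)) *s w)" for D
      using nabla_e_2n_iff[OF tan _ _ d, of 0 D] w by (simp add: horizontal_lift_def)
    moreover have "- horizontal_lift p ((phase \<gamma> s / of_real (xcomp \<gamma> s)) *s w) + inv_alpha I \<gamma> p *\<^sub>R cstr p v
        = horizontal_lift p ((- (phase \<gamma> s / of_real (xcomp \<gamma> s)) + of_real (inv_alpha I \<gamma> p) * \<i>) *s w)"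
      unfolding cstr_eq w(1) horizontal_lift_linear scaleR_eq_vector_smult fst_horizontal_lift
      by (simp add: vec_eq_iff algebra_simps)
    ultimately show ?thesis
      unfolding coeff scaleR_eq_vector_smult[symmetric] horizontal_lift_linear[symmetric] w(1)[symmetric]
      by auto
  qed
  obtain w where "w \<noteq> 0" "inner (fst p) w = 0" "inner (\<i> *s fst p) w = 0"
    using exists_complex_orthogonal[OF True] by blast
  then have w: "horizontal_lift p w \<in> xi_prime (rot_surface I \<gamma>) p" "horizontal_lift p w \<noteq> 0"
    by (auto simp: xi_prime_rot_surface[OF gen inj sI ps] horizontal_lift_def zero_prod_def)
  have "(\<forall>v\<in>xi_prime (rot_surface I \<gamma>) p. \<exists>D. has_nabla (rot_surface I \<gamma>) (e_2n I \<gamma>) p v D \<and>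
      - D + inv_alpha I \<gamma> p *\<^sub>R cstr p v = k *\<^sub>R v) \<longleftrightarrow> k = ?k" for k
    using iff w by (metis scaleR_right_imp_eq)
  then show ?thesis using True by (simp add: inv_k_def)
qed

text \<open>The vector \<open>e\<^sub>n\<close> moves the parameter with speed \<open>m = x / D\<close>. Of the two terms of the formula, the
  first is the rotation of the phase, the second is the rotation of \<open>z\<close> itself along \<open>e\<^sub>n\<close>.\<close>

lemma inv_l_eq:
  assumes \<psi>: "((\<lambda>r. phase \<gamma> r) has_vector_derivative \<i> * of_real \<psi> * phase \<gamma> s) (at s)"
  shows "inv_l I \<gamma> p = (xcomp \<gamma> s * \<psi> - deriv (tcomp \<gamma>) s / xcomp \<gamma> s) / contact_speed \<gamma> s"
proof -
  define x x' t' D where defs: "x = xcomp \<gamma> s" "x' = deriv (xcomp \<gamma>) s" "t' = deriv (tcomp \<gamma>) s"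
    "D = contact_speed \<gamma> s"
  have x: "x > 0" "norm (fst p) = x" using generating_curveD(1)[OF gen sI] at_point[OF gen inj sI ps] by (auto simp: defs)
  have D: "D > 0" unfolding defs by (rule generating_curveD(7)[OF gen sI])
  define l where "l = (x * \<psi> - t' / x) / D"
  define c where "c = - \<i> * phase \<gamma> s / of_real x"
  have e: "e_n I \<gamma> p = horizontal_lift p (c *s fst p)"
    unfolding c_def defs by (rule e_n_eq[OF gen inj sI ps])
  have cnz: "c *s fst p \<noteq> 0"
    using phase_nz[OF gen inj sI ps] x at_point(4)[OF gen inj sI ps] by (simp add: c_def)
  have "phase \<gamma> s * cnj (phase \<gamma> s) = 1"
    using cmod_phase[OF gen sI] by (simp add: complex_norm_square[symmetric])
  then have "phase \<gamma> s * cnj c = \<i> / of_real x"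
    by (simp add: c_def mult_ac)
  then have "inner (phase \<gamma> s *s fst p) (c *s fst p) = 0"
    unfolding inner_vector_smult by simp
  then have tan: "e_n I \<gamma> p \<in> tangent_space (rot_surface I \<gamma>) p"
    using xi_tangent_rot_surface[OF gen inj sI ps] e unfolding xi_tangent_def by blast
  have 1: "inner (fst p) (c *s fst p) = x * (x' * (x / D))"
    using inner_vector_smult[of 1 "fst p" c] x D
    by (simp add: c_def phase_def defs[symmetric] power2_eq_square)
  have 2: "snd (e_n I \<gamma> p) = t' * (x / D)"
    using inner_vector_smult[of \<i> "fst p" c] x D
    by (simp add: e horizontal_lift_def c_def phase_def defs[symmetric] power2_eq_square)
  have "of_real (x / D) * (\<i> * of_real \<psi> - of_real (x' / x)) - \<i> * phase \<gamma> s / of_real x = \<i> * of_real l"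
    using x D by (simp add: complex_eq_iff phase_def defs[symmetric] l_def field_simps)
  then have "phase \<gamma> s / of_real x * (of_real (x / D) * (\<i> * of_real \<psi> - of_real (x' / x)) - \<i> * phase \<gamma> s / of_real x)
      = - of_real l * c"
    by (simp add: c_def)
  also have "phase \<gamma> s / of_real x * (of_real (x / D) * (\<i> * of_real \<psi> - of_real (x' / x)) - \<i> * phase \<gamma> s / of_real x)
     = of_real (x / D) * (\<i> * of_real \<psi> * phase \<gamma> s / of_real x - phase \<gamma> s * of_real (x' / x\<^sup>2))
      + phase \<gamma> s / of_real x * c"
    using x D by (simp add: c_def field_simps power2_eq_square)
  finally have coeff: "of_real (x / D) * (\<i> * of_real \<psi> * phase \<gamma> s / of_real x - phase \<gamma> s * of_real (x' / x\<^sup>2))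
      + phase \<gamma> s / of_real x * c = - of_real l * c" .
  have "has_nabla (rot_surface I \<gamma>) (e_2n I \<gamma>) p (e_n I \<gamma> p) D' \<longleftrightarrow>
      D' = horizontal_lift p ((- of_real l * c) *s fst p)" for D'
    unfolding coeff[symmetric] vector_sadd_rdistrib vector_smult_assoc[symmetric]
    using nabla_e_2n_iff[OF tan _ _ phase_over_x_derivative[OF \<psi>], of "x / D" D'] 1 2
    unfolding defs[symmetric] e fst_horizontal_lift vector_smult_assoc by simp
  then have "(\<exists>D'. has_nabla (rot_surface I \<gamma>) (e_2n I \<gamma>) p (e_n I \<gamma> p) D' \<and> - D' = m *\<^sub>R e_n I \<gamma> p)
      \<longleftrightarrow> l *\<^sub>R (c *s fst p) = m *\<^sub>R (c *s fst p)" for m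
    by (simp add: e horizontal_lift_linear scaleR_eq_vector_smult)
  then have "(\<exists>D'. has_nabla (rot_surface I \<gamma>) (e_2n I \<gamma>) p (e_n I \<gamma> p) D' \<and> - D' = m *\<^sub>R e_n I \<gamma> p)
      \<longleftrightarrow> m = l" for m
    using cnz by (metis scaleR_right_imp_eq)
  then show ?thesis unfolding inv_l_def l_def[symmetric] defs[symmetric] by simp
qed

end


section \<open>Profiles with zero curvature and prescribed energy\<close>

lemma x_rangeD:
  assumes "n \<ge> 1" "x \<in> x_range n E"
  shows "x > 0" "\<bar>E\<bar> < x ^ (2 * n - 1)"
proof -
  define m where "m = 2 * n - 1"
  have m: "m > 0" "real m = 2 * real n - 1" using assms(1) by (auto simp: m_def)
  have x: "\<bar>E\<bar> powr (1 / real m) < x" using assms(2) by (simp add: x_range_def m)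
  then show "x > 0" using powr_ge_zero[of "\<bar>E\<bar>" "1 / real m"] by linarith
  have "\<bar>E\<bar> = (\<bar>E\<bar> powr (1 / real m)) ^ m"
    using m(1) by (cases "E = 0") (auto simp: powr_realpow[symmetric] powr_powr)
  also have "\<dots> < x ^ m" using x m(1) by (intro power_strict_mono) auto
  finally show "\<bar>E\<bar> < x ^ (2 * n - 1)" by (simp add: m_def)
qed

lemma x_range_eq: "x_range n E = {\<bar>E\<bar> powr (1 / (2 * real n - 1)) <..}"
  by (auto simp: x_range_def)

lemma x_range_interval:
  "open (x_range n E)" "is_interval (x_range n E)" "x_range n E \<noteq> {}" "convex (x_range n E)"
  unfolding x_range_eq by (simp_all add: is_interval_1)

lemma x_range_uminus: "x_range n (- E) = x_range n E"
  by (simp add: x_range_def)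

text \<open>Vanishing \<open>p\<close>-mean curvature together with the energy fixes the phase up to the sign of its imaginary part:
  it is \<open>cos_phase \<plusminus> \<i> sin_phase\<close> at \<open>x\<close>.\<close>

definition cos_phase :: "nat \<Rightarrow> real \<Rightarrow> real \<Rightarrow> real" where
  "cos_phase n E x = E / x ^ (2 * n - 1)"

definition sin_phase :: "nat \<Rightarrow> real \<Rightarrow> real \<Rightarrow> real" where
  "sin_phase n E x = sqrt (1 - (cos_phase n E x)\<^sup>2)"

text \<open>The derivative \<open>dt / dx\<close> of the profile of \<open>\<Sigma>\<^sup>+\<close>.\<close>

definition profile_slope :: "nat \<Rightarrow> real \<Rightarrow> real \<Rightarrow> real" where
  "profile_slope n E x = x * cos_phase n E x / sin_phase n E x"

lemma sin_phase:
  assumes "n \<ge> 1" "x \<in> x_range n E"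
  shows "sin_phase n E x > 0" "(sin_phase n E x)\<^sup>2 = 1 - (cos_phase n E x)\<^sup>2"
proof -
  have "\<bar>cos_phase n E x\<bar> < 1"
    using x_rangeD[OF assms] by (simp add: cos_phase_def abs_divide)
  then have "(cos_phase n E x)\<^sup>2 < 1" by (simp add: abs_square_less_1)
  then show "sin_phase n E x > 0" "(sin_phase n E x)\<^sup>2 = 1 - (cos_phase n E x)\<^sup>2"
    by (simp_all add: sin_phase_def)
qed

lemma x_times_cos_phase:
  assumes "n \<ge> 1" "x > 0"
  shows "x * cos_phase n E x = E / x ^ (2 * n - 2)"
proof -
  have "2 * n - 1 = Suc (2 * n - 2)" using assms(1) by simp
  then have "x ^ (2 * n - 1) = x * x ^ (2 * n - 2)" by (metis power_Suc)
  then show ?thesis using assms by (simp add: cos_phase_def)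
qed

lemma phase_continuous:
  assumes "n \<ge> 1"
  shows "continuous_on (x_range n E) (cos_phase n E)" "continuous_on (x_range n E) (sin_phase n E)"
proof -
  show "continuous_on (x_range n E) (cos_phase n E)"
    unfolding cos_phase_def using x_rangeD(1)[OF assms] by (intro continuous_intros) force
  then show "continuous_on (x_range n E) (sin_phase n E)"
    unfolding sin_phase_def by (intro continuous_intros)
qed

text \<open>A point of the orbit belonging to a point of the \<open>(x, t)\<close>-plane, used to pass from equations between
  hypersurfaces back to equations between generating curves.\<close>

definition sample_point :: "real \<times> real \<Rightarrow> 'n::finite heis" where
  "sample_point a = (axis undefined (of_real (fst a)), snd a)"

lemma sample_point:
  assumes "fst a > 0"
  shows "(norm (fst (sample_point a :: 'n::finite heis)), snd (sample_point a :: 'n heis)) = a"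
  using assms by (simp add: sample_point_def prod_eq_iff inner_axis_axis inner_complex_def
      norm_eq_sqrt_inner[of "axis undefined (complex_of_real (fst a))"])

lemma sample_point_in_rot_surface:
  assumes "fst a > 0"
  shows "(sample_point a :: 'n::finite heis) \<in> rot_surface I \<gamma> \<longleftrightarrow> a \<in> \<gamma> ` I"
  unfolding rot_surface_def mem_Collect_eq sample_point[OF assms] by auto

lemma reflected_generating_curve:
  assumes refl: "reflection ` (rot_surface I \<gamma> :: 'n::finite heis set) = rot_surface I' \<gamma>'"
    and pos: "\<And>s. s \<in> I \<Longrightarrow> xcomp \<gamma> s > 0" "\<And>s. s \<in> I' \<Longrightarrow> xcomp \<gamma>' s > 0"
  shows "\<gamma>' ` I' = (\<lambda>a. (fst a, - snd a)) ` \<gamma> ` I"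
proof -
  have "a \<in> \<gamma>' ` I' \<longleftrightarrow> (fst a, - snd a) \<in> \<gamma> ` I" if a: "fst a > 0" for a
  proof -
    have r: "reflection (reflection p) = p" for p :: "'n heis" by (simp add: reflection_def)
    have "a \<in> \<gamma>' ` I' \<longleftrightarrow> sample_point a \<in> reflection ` (rot_surface I \<gamma> :: 'n heis set)"
      unfolding refl sample_point_in_rot_surface[OF a] ..
    also have "\<dots> \<longleftrightarrow> reflection (sample_point a) \<in> (rot_surface I \<gamma> :: 'n heis set)"
      by (metis r image_iff)
    also have "reflection (sample_point a :: 'n heis) = sample_point (fst a, - snd a)"
      by (simp add: reflection_def sample_point_def)
    also have "\<dots> \<in> (rot_surface I \<gamma> :: 'n heis set) \<longleftrightarrow> (fst a, - snd a) \<in> \<gamma> ` I"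
      using a by (intro sample_point_in_rot_surface) simp
    finally show ?thesis .
  qed
  then have eq: "a \<in> \<gamma>' ` I' \<longleftrightarrow> fst a > 0 \<and> (fst a, - snd a) \<in> \<gamma> ` I" for a
    using pos(2) by (cases "fst a > 0") force+
  show ?thesis
  proof (intro set_eqI iffI)
    fix a assume "a \<in> \<gamma>' ` I'"
    then show "a \<in> (\<lambda>a. (fst a, - snd a)) ` \<gamma> ` I"
      unfolding eq by (intro image_eqI[of _ _ "(fst a, - snd a)"]) auto
  next
    fix a assume "a \<in> (\<lambda>a. (fst a, - snd a)) ` \<gamma> ` I"
    then obtain s where "s \<in> I" "a = (fst (\<gamma> s), - snd (\<gamma> s))" by auto
    then show "a \<in> \<gamma>' ` I'" using pos(1) by (simp add: eq)
  qed
qed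

text \<open>For \<open>H = 0\<close> the energy is \<open>- k x\<^sup>2\<^sup>n\<close>, so the formula for \<open>k\<close> is a first integral and yields
  \<open>t' / D = E / x\<^sup>2\<^sup>n\<^sup>-\<^sup>1\<close>. The modulus of \<open>x x' / D\<close> follows from the definition of \<open>D\<close>, its sign
  from that of \<open>\<alpha>\<close>; over the open range it never vanishes.\<close>

lemma minimal_phase:
  fixes \<gamma> :: "real \<Rightarrow> real \<times> real"
  assumes gen: "generating_curve I \<gamma>" and inj: "inj_on (xcomp \<gamma>) I"
    and range: "xcomp \<gamma> ` I \<subseteq> x_range CARD('n::finite) E"
    and min: "\<And>p :: 'n heis. p \<in> rot_surface I \<gamma> \<Longrightarrow> p_mean_curvature I \<gamma> p = 0 \<and> energy I \<gamma> p = E"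
    and alpha: "\<And>p :: 'n heis. p \<in> rot_surface I \<gamma> \<Longrightarrow> 0 \<le> \<sigma> * inv_alpha I \<gamma> p"
    and \<sigma>: "\<sigma> = 1 \<or> \<sigma> = - 1" and s: "s \<in> I"
  shows "deriv (tcomp \<gamma>) s = contact_speed \<gamma> s * cos_phase CARD('n) E (xcomp \<gamma> s)"
    "xcomp \<gamma> s * deriv (xcomp \<gamma>) s = contact_speed \<gamma> s * (\<sigma> * sin_phase CARD('n) E (xcomp \<gamma> s))"
proof -
  define p :: "'n heis" where "p = sample_point (\<gamma> s)"
  define x x' t' D where defs: "x = xcomp \<gamma> s" "x' = deriv (xcomp \<gamma>) s" "t' = deriv (tcomp \<gamma>) s"
    "D = contact_speed \<gamma> s"
  let ?m = "2 * CARD('n) - 1"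
  have n: "CARD('n) \<ge> 1" by (simp add: Suc_leI)
  have x: "x > 0" unfolding defs by (rule generating_curveD(1)[OF gen s])
  have D: "D > 0" unfolding defs by (rule generating_curveD(7)[OF gen s])
  have D2: "D\<^sup>2 = (x * x')\<^sup>2 + t'\<^sup>2" unfolding defs by (rule contact_speed_sq)
  have ps: "(norm (fst p), snd p) = \<gamma> s"
    unfolding p_def using x by (intro sample_point) (simp add: defs)
  note p = at_point[OF gen inj s ps]
  have "p_mean_curvature I \<gamma> p = 0" "energy I \<gamma> p = E" using min[OF p(3)] by auto
  then have "- inv_k I \<gamma> p * x ^ (2 * CARD('n)) = E"
    by (simp add: energy_def p(1)[symmetric] defs)
  moreover have "x ^ (2 * CARD('n)) = x * x ^ ?m"
    using n by (simp add: power_Suc[symmetric] del: power_Suc)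
  ultimately have "t' / (x * D) * (x * x ^ ?m) = E"
    using inv_k_eq[OF gen inj s ps] by (simp add: defs)
  then have "t' * x ^ ?m = D * E" using x D by (simp add: field_simps)
  then have t: "t' = D * cos_phase CARD('n) E x" using x by (simp add: cos_phase_def field_simps)
  then show "deriv (tcomp \<gamma>) s = contact_speed \<gamma> s * cos_phase CARD('n) E (xcomp \<gamma> s)"
    by (simp add: defs)
  have xr: "x \<in> x_range CARD('n) E" using range s by (auto simp: defs)
  have "(\<sigma> * (x * x' / D))\<^sup>2 = (x * x')\<^sup>2 / D\<^sup>2"
    using \<sigma> by (auto simp: power_divide)
  also have "(x * x')\<^sup>2 = D\<^sup>2 * (1 - (cos_phase CARD('n) E x)\<^sup>2)"
    using D2 t by (simp add: algebra_simps power_mult_distrib)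
  also have "D\<^sup>2 * (1 - (cos_phase CARD('n) E x)\<^sup>2) / D\<^sup>2 = (sin_phase CARD('n) E x)\<^sup>2"
    using D by (simp add: sin_phase(2)[OF n xr])
  finally have sq: "(\<sigma> * (x * x' / D))\<^sup>2 = (sin_phase CARD('n) E x)\<^sup>2" .
  have "0 \<le> \<sigma> * (x * x' / D)"
    using alpha[OF p(3)] x inv_alpha_eq[OF gen inj s ps] mult_nonneg_nonneg[of x "\<sigma> * (x' / D)"]
    by (simp add: defs mult_ac)
  from power2_eq_imp_eq[OF sq this less_imp_le[OF sin_phase(1)[OF n xr]]]
  have "\<sigma> * (x * x' / D) = sin_phase CARD('n) E x" .
  then have "x * x' = D * (\<sigma> * sin_phase CARD('n) E x)"
    using \<sigma> D by (auto simp: field_simps)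
  then show "xcomp \<gamma> s * deriv (xcomp \<gamma>) s = contact_speed \<gamma> s * (\<sigma> * sin_phase CARD('n) E (xcomp \<gamma> s))"
    by (simp add: defs)
qed

text \<open>With a nowhere vanishing \<open>x'\<close> the profile is a graph \<open>t = \<tau> x\<close>, and the parametrisation cancels in
  \<open>t' / x'\<close>. The slope depends on \<open>E\<close> and \<open>\<sigma>\<close> only, which is the source of uniqueness.\<close>

lemma graph_slope:
  assumes gen: "generating_curve I \<gamma>" and inj: "inj_on (xcomp \<gamma>) I"
    and n: "n \<ge> 1" and range: "xcomp \<gamma> ` I = x_range n E" and \<sigma>: "\<sigma> = 1 \<or> \<sigma> = - 1"
    and t: "\<And>s. s \<in> I \<Longrightarrow> deriv (tcomp \<gamma>) s = contact_speed \<gamma> s * cos_phase n E (xcomp \<gamma> s)"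
    and x: "\<And>s. s \<in> I \<Longrightarrow>
      xcomp \<gamma> s * deriv (xcomp \<gamma>) s = contact_speed \<gamma> s * (\<sigma> * sin_phase n E (xcomp \<gamma> s))"
  obtains \<tau> where "\<gamma> ` I = (\<lambda>x. (x, \<tau> x)) ` x_range n E"
    "\<And>x. x \<in> x_range n E \<Longrightarrow> (\<tau> has_real_derivative \<sigma> * profile_slope n E x) (at x)"
proof (rule that)
  define \<tau> where "\<tau> x = tcomp \<gamma> (inv_into I (xcomp \<gamma>) x)" for x
  have inv: "inv_into I (xcomp \<gamma>) (xcomp \<gamma> s) = s" if "s \<in> I" for s
    by (rule inv_into_f_f[OF inj that])
  show "\<gamma> ` I = (\<lambda>x. (x, \<tau> x)) ` x_range n E"
    unfolding range[symmetric] image_image by (intro image_cong refl) (simp add: \<tau>_def inv)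
  fix x assume "x \<in> x_range n E"
  then obtain s where s: "s \<in> I" "x = xcomp \<gamma> s" using range by auto
  note d = generating_curveD[OF gen s(1)]
  have sp: "sin_phase n E x > 0" by (rule sin_phase(1)[OF n \<open>x \<in> x_range n E\<close>])
  then have nz: "deriv (xcomp \<gamma>) s \<noteq> 0" using x[OF s(1)] d(7) \<sigma> s(2) by auto
  have "open I" using gen by (simp add: generating_curve_def)
  have "(inv_into I (xcomp \<gamma>) has_real_derivative inverse (deriv (xcomp \<gamma>) s)) (at x)"
    unfolding s(2) using generating_curveD(2)[OF gen] nz
    by (intro inv_into_derivative[OF \<open>open I\<close> inj s(1)])
  from DERIV_chain2[OF _ this, of "tcomp \<gamma>" "deriv (tcomp \<gamma>) s"]
  have "(\<tau> has_real_derivative deriv (tcomp \<gamma>) s * inverse (deriv (xcomp \<gamma>) s)) (at x)"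
    using d(3) unfolding \<tau>_def[abs_def] s(2) by (simp only: inv[OF s(1)])
  also have "deriv (tcomp \<gamma>) s * inverse (deriv (xcomp \<gamma>) s) = \<sigma> * profile_slope n E x"
  proof -
    have "deriv (xcomp \<gamma>) s = contact_speed \<gamma> s * (\<sigma> * sin_phase n E x) / x"
      using x[OF s(1)] d(1) s(2) by (simp add: field_simps)
    then show ?thesis
      unfolding t[OF s(1)] profile_slope_def s(2)[symmetric] using sp d(1,7) s(2) \<sigma>
      by (auto simp: divide_simps) (simp_all add: mult.commute)
  qed
  finally show "(\<tau> has_real_derivative \<sigma> * profile_slope n E x) (at x)" .
qed

text \<open>Horizontal arc-length means \<open>D = x\<close>; then \<open>G\<close> is the inverse function of the \<open>x\<close>-component.\<close>

lemma arclength_imp_explicit: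
  assumes gen: "generating_curve I \<gamma>" and inj: "inj_on (xcomp \<gamma>) I"
    and n: "n \<ge> 1" and range: "xcomp \<gamma> ` I = x_range n E" and \<sigma>: "\<sigma> = 1 \<or> \<sigma> = - 1"
    and t: "\<And>s. s \<in> I \<Longrightarrow> deriv (tcomp \<gamma>) s = contact_speed \<gamma> s * cos_phase n E (xcomp \<gamma> s)"
    and x: "\<And>s. s \<in> I \<Longrightarrow>
      xcomp \<gamma> s * deriv (xcomp \<gamma>) s = contact_speed \<gamma> s * (\<sigma> * sin_phase n E (xcomp \<gamma> s))"
    and arc: "horizontal_arclength I \<gamma>"
  shows "explicit_curve n E \<sigma> I \<gamma>"
proof -
  have D: "contact_speed \<gamma> s = xcomp \<gamma> s" if "s \<in> I" for s
  proof -
    have x: "xcomp \<gamma> s > 0" by (rule generating_curveD(1)[OF gen that])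
    have "(deriv (xcomp \<gamma>) s)\<^sup>2 + (deriv (tcomp \<gamma>) s)\<^sup>2 / (xcomp \<gamma> s)\<^sup>2 = 1"
      using arc that by (simp add: horizontal_arclength_def)
    then have "(xcomp \<gamma> s * deriv (xcomp \<gamma>) s)\<^sup>2 + (deriv (tcomp \<gamma>) s)\<^sup>2 = (xcomp \<gamma> s)\<^sup>2"
      using x by (simp add: field_simps power_mult_distrib)
    then show ?thesis using x by (simp add: contact_speed_def)
  qed
  have inv: "inv_into I (xcomp \<gamma>) (xcomp \<gamma> s) = s" if "s \<in> I" for s
    by (rule inv_into_f_f[OF inj that])
  have "open I" using gen by (simp add: generating_curve_def)
  define G where "G = inv_into I (xcomp \<gamma>)"
  have G: "G (xcomp \<gamma> s) = s" if "s \<in> I" for s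
    using inv that by (simp add: G_def)
  have xd: "deriv (xcomp \<gamma>) s = \<sigma> * sin_phase n E (xcomp \<gamma> s)" if "s \<in> I" for s
    using x[OF that] D[OF that] generating_curveD(1)[OF gen that] by simp
  have injG: "inj_on G (x_range n E)"
    unfolding range[symmetric] by (auto simp: inj_on_def G)
  show ?thesis unfolding explicit_curve_def
  proof (intro exI[of _ G] conjI ballI)
    fix x assume xr: "x \<in> x_range n E"
    then obtain s where s: "s \<in> I" "x = xcomp \<gamma> s" using range by auto
    have "(G has_real_derivative inverse (deriv (xcomp \<gamma>) s)) (at x)"
      unfolding s(2) G_def using generating_curveD(2)[OF gen] sin_phase(1)[OF n xr] \<sigma> s(2)
      by (intro inv_into_derivative[OF \<open>open I\<close> inj s(1)]) (auto simp: xd[OF s(1)])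
    then show "(G has_real_derivative \<sigma> / sqrt (1 - (E / x ^ (2 * n - 1))\<^sup>2)) (at x)"
      using \<sigma> xd[OF s(1)] by (auto simp: s(2) sin_phase_def cos_phase_def inverse_eq_divide)
  next
    show "inj_on G (x_range n E)" by (rule injG)
    show "I = G ` x_range n E"
      unfolding range[symmetric] image_image by (simp add: G)
  next
    fix s assume s: "s \<in> I"
    then have "xcomp \<gamma> s \<in> x_range n E" using range by auto
    from inv_into_f_f[OF injG this] show "xcomp \<gamma> s = inv_into (x_range n E) G s"
      by (simp add: G s)
    have "deriv (tcomp \<gamma>) s = E / xcomp \<gamma> s ^ (2 * n - 2)"
      using t[OF s] D[OF s] x_times_cos_phase[OF n generating_curveD(1)[OF gen s]] by simp
    then show "(tcomp \<gamma> has_real_derivative E / xcomp \<gamma> s ^ (2 * n - 2)) (at s)"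
      using generating_curveD(3)[OF gen s] by simp
  qed
qed


section \<open>Smoothness of the explicit curves\<close>

text \<open>The function ring generated by \<open>B\<close> and the constants. If it is closed under differentiation, all of its
  members are smooth; this replaces a calculus of iterated derivatives of compositions and inverses.\<close>

inductive_set polynomials_in :: "(real \<Rightarrow> real) set \<Rightarrow> (real \<Rightarrow> real) set" for B where
  generator: "f \<in> B \<Longrightarrow> f \<in> polynomials_in B"
| const: "(\<lambda>s. c) \<in> polynomials_in B"
| add: "f \<in> polynomials_in B \<Longrightarrow> g \<in> polynomials_in B \<Longrightarrow> (\<lambda>s. f s + g s) \<in> polynomials_in B"
| mult: "f \<in> polynomials_in B \<Longrightarrow> g \<in> polynomials_in B \<Longrightarrow> (\<lambda>s. f s * g s) \<in> polynomials_in B"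

lemma polynomials_in_power:
  assumes "f \<in> polynomials_in B"
  shows "(\<lambda>s. f s ^ k) \<in> polynomials_in B"
proof (induction k)
  case 0
  show ?case using polynomials_in.const[of 1] by simp
next
  case (Suc k)
  show ?case using polynomials_in.mult[OF assms Suc] by simp
qed

lemma smooth_curve_on_polynomials_in:
  assumes "open I"
    and B: "\<And>b. b \<in> B \<Longrightarrow> \<exists>b'\<in>polynomials_in B. \<forall>s\<in>I. (b has_real_derivative b' s) (at s)"
    and f: "f \<in> polynomials_in B"
  shows "smooth_curve_on I f"
proof -
  have closed: "\<exists>g'\<in>polynomials_in B. \<forall>s\<in>I. (g has_real_derivative g' s) (at s)"
    if "g \<in> polynomials_in B" for g
    using that
  proof induction
    case (generator f)
    then show ?case by (rule B)
  next
    case (const c)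
    show ?case by (rule bexI[of _ "\<lambda>s. 0"]) (auto intro: polynomials_in.const)
  next
    case (add f g)
    then obtain f' g' where "f' \<in> polynomials_in B" "g' \<in> polynomials_in B"
      "\<forall>s\<in>I. (f has_real_derivative f' s) (at s)" "\<forall>s\<in>I. (g has_real_derivative g' s) (at s)"
      by blast
    then show ?case
      by (intro bexI[of _ "\<lambda>s. f' s + g' s"]) (auto intro: polynomials_in.add DERIV_add)
  next
    case (mult f g)
    then obtain f' g' where "f' \<in> polynomials_in B" "g' \<in> polynomials_in B"
      "\<forall>s\<in>I. (f has_real_derivative f' s) (at s)" "\<forall>s\<in>I. (g has_real_derivative g' s) (at s)"
      by blast
    then show ?case using mult.hyps
      by (intro bexI[of _ "\<lambda>s. f' s * g s + g' s * f s"])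
        (auto intro: polynomials_in.add polynomials_in.mult DERIV_mult)
  qed
  have iter: "\<exists>g\<in>polynomials_in B. \<forall>s\<in>I. (deriv ^^ k) f s = g s" for k
  proof (induction k)
    case 0
    show ?case using f by auto
  next
    case (Suc k)
    then obtain g g' where g: "\<forall>s\<in>I. (deriv ^^ k) f s = g s" "g' \<in> polynomials_in B"
      "\<forall>s\<in>I. (g has_real_derivative g' s) (at s)"
      using closed by meson
    have "(deriv ^^ Suc k) f s = g' s" if s: "s \<in> I" for s
    proof -
      have "((deriv ^^ k) f has_real_derivative g' s) (at s)"
        using g(1,3) s \<open>open I\<close> by (metis has_field_derivative_transform_within_open)
      then show ?thesis by (simp add: DERIV_imp_deriv)
    qed
    then show ?case using g(2) by blast
  qed
  show ?thesis unfolding smooth_curve_on_def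
  proof (intro allI ballI)
    fix k s assume s: "s \<in> I"
    obtain g g' where "\<forall>s\<in>I. (deriv ^^ k) f s = g s" "\<forall>s\<in>I. (g has_real_derivative g' s) (at s)"
      using iter[of k] closed by meson
    then have "((deriv ^^ k) f has_real_derivative g' s) (at s)"
      using s \<open>open I\<close> by (metis has_field_derivative_transform_within_open)
    then show "(deriv ^^ k) f field_differentiable at s"
      unfolding field_differentiable_def by blast
  qed
qed

section \<open>Curvature and energy of the explicit curves\<close>

text \<open>Inverting \<open>G\<close> turns the antiderivative into an autonomous differential equation for \<open>x\<close>.\<close>

lemma explicit_curve_ode:
  assumes n: "n \<ge> 1" and \<sigma>: "\<sigma> = 1 \<or> \<sigma> = - 1" and ex: "explicit_curve n E \<sigma> I \<gamma>"
  shows "open I" "is_interval I" "I \<noteq> {}" "xcomp \<gamma> ` I = x_range n E" "inj_on (xcomp \<gamma>) I"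
    "\<And>s. s \<in> I \<Longrightarrow> (xcomp \<gamma> has_real_derivative \<sigma> * sin_phase n E (xcomp \<gamma> s)) (at s)"
    "\<And>s. s \<in> I \<Longrightarrow> (tcomp \<gamma> has_real_derivative xcomp \<gamma> s * cos_phase n E (xcomp \<gamma> s)) (at s)"
proof -
  let ?X = "x_range n E"
  obtain G where G: "\<And>x. x \<in> ?X \<Longrightarrow> (G has_real_derivative \<sigma> / sqrt (1 - (E / x ^ (2 * n - 1))\<^sup>2)) (at x)"
    "inj_on G ?X" "I = G ` ?X" "\<And>s. s \<in> I \<Longrightarrow> xcomp \<gamma> s = inv_into ?X G s"
    "\<And>s. s \<in> I \<Longrightarrow> (tcomp \<gamma> has_real_derivative E / xcomp \<gamma> s ^ (2 * n - 2)) (at s)"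
    using ex unfolding explicit_curve_def by metis
  have G': "(G has_real_derivative \<sigma> / sin_phase n E x) (at x)" if "x \<in> ?X" for x
    using G(1)[OF that] by (simp add: sin_phase_def cos_phase_def)
  have cont: "continuous_on ?X G"
    using G' by (meson DERIV_isCont continuous_at_imp_continuous_on)
  show o: "open I"
    unfolding G(3) by (rule invariance_of_domain[OF cont x_range_interval(1) G(2)])
  show "is_interval I"
    unfolding G(3) using x_range_interval(2) cont
    by (auto simp: is_interval_connected_1 intro: connected_continuous_image)
  show "I \<noteq> {}" using x_range_interval(3) by (simp add: G(3))
  have xG: "xcomp \<gamma> (G x) = x" if "x \<in> ?X" for x
    using G(4)[of "G x"] that inv_into_f_f[OF G(2) that] G(3) by simp
  show range: "xcomp \<gamma> ` I = ?X"
    unfolding G(3) image_image using xG by simp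
  show "inj_on (xcomp \<gamma>) I"
    unfolding G(3) inj_on_def using xG by auto
  fix s assume s: "s \<in> I"
  define x where "x = xcomp \<gamma> s"
  have x: "x \<in> ?X" using range s unfolding x_def by blast
  have sG: "s = G x" using s xG unfolding G(3) x_def by auto
  have "(inv_into ?X G has_real_derivative inverse (\<sigma> / sin_phase n E x)) (at s)"
    unfolding sG using G' sin_phase(1)[OF n x] \<sigma>
    by (intro inv_into_derivative[OF x_range_interval(1) G(2) x]) auto
  then have "(xcomp \<gamma> has_real_derivative inverse (\<sigma> / sin_phase n E x)) (at s)"
    by (rule has_field_derivative_transform_within_open[OF _ o s]) (simp add: G(4))
  then show "(xcomp \<gamma> has_real_derivative \<sigma> * sin_phase n E (xcomp \<gamma> s)) (at s)"
    using \<sigma> by (auto simp: x_def)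
  show "(tcomp \<gamma> has_real_derivative xcomp \<gamma> s * cos_phase n E (xcomp \<gamma> s)) (at s)"
    using G(5)[OF s] x_times_cos_phase[OF n x_rangeD(1)[OF n x]] by (simp add: x_def)
qed

text \<open>Smoothness: with \<open>q = cos_phase\<close>, \<open>w = sin_phase\<close> taken along the curve and \<open>m = 2 n - 1\<close>, the functions
  \<open>x\<close>, \<open>t\<close>, \<open>1 / x\<close>, \<open>q\<close>, \<open>w\<close> have the derivatives \<open>\<sigma> w\<close>, \<open>x q\<close>, \<open>- \<sigma> w / x\<^sup>2\<close>, \<open>- m \<sigma> q w / x\<close>,
  \<open>m \<sigma> q\<^sup>2 / x\<close>, which are again polynomials in these functions. The same formulas show that the phase
  \<open>q + \<i> \<sigma> w\<close> rotates with angular speed \<open>m q / x\<close>.\<close>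

lemma explicit_generating_curve:
  assumes n: "n \<ge> 1" and \<sigma>: "\<sigma> = 1 \<or> \<sigma> = - 1" and ex: "explicit_curve n E \<sigma> I \<gamma>"
  shows "generating_curve I \<gamma>"
    "\<And>s. s \<in> I \<Longrightarrow> contact_speed \<gamma> s = xcomp \<gamma> s"
    "horizontal_arclength I \<gamma>"
    "\<And>s. s \<in> I \<Longrightarrow> phase \<gamma> s = Complex (cos_phase n E (xcomp \<gamma> s)) (\<sigma> * sin_phase n E (xcomp \<gamma> s))"
    "\<And>s. s \<in> I \<Longrightarrow> ((\<lambda>r. phase \<gamma> r) has_vector_derivative
       \<i> * of_real ((2 * real n - 1) * cos_phase n E (xcomp \<gamma> s) / xcomp \<gamma> s) * phase \<gamma> s) (at s)"
proof -
  note ode = explicit_curve_ode[OF n \<sigma> ex]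
  define x q w where "x = xcomp \<gamma>" and "q s = cos_phase n E (x s)" and "w s = sin_phase n E (x s)" for s
  have xr: "x s \<in> x_range n E" if "s \<in> I" for s using ode(4) that unfolding x_def by blast
  have pos: "x s > 0" "w s > 0" "(w s)\<^sup>2 = 1 - (q s)\<^sup>2" if "s \<in> I" for s
    using x_rangeD[OF n xr[OF that]] sin_phase[OF n xr[OF that]] by (auto simp: q_def w_def)
  have \<sigma>2: "\<sigma> * \<sigma> = 1" using \<sigma> by auto
  have m: "real (2 * n - 1) = 2 * real n - 1" using n by simp
  have x': "(x has_real_derivative \<sigma> * w s) (at s)" and t': "(tcomp \<gamma> has_real_derivative x s * q s) (at s)"
    if "s \<in> I" for s
    using ode(6,7)[OF that] by (auto simp: x_def w_def q_def)
  have q': "(q has_real_derivative - (2 * real n - 1) * \<sigma> * q s * w s * inverse (x s)) (at s)" if s: "s \<in> I" for s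
  proof -
    have "2 * n - 1 = Suc (2 * n - 2)" using n by simp
    then have e: "x s ^ (2 * n - 1) = x s * x s ^ (2 * n - 1 - Suc 0)" by (metis diff_Suc_Suc diff_zero power_Suc)
    have "((\<lambda>r. E / x r ^ (2 * n - 1)) has_real_derivative
       - (E * (real (2 * n - 1) * (\<sigma> * w s * x s ^ (2 * n - 1 - Suc 0)))) / (x s ^ (2 * n - 1) * x s ^ (2 * n - 1))) (at s)"
      using x'[OF s] pos(1)[OF s] by (auto intro!: derivative_eq_intros)
    also have "- (E * (real (2 * n - 1) * (\<sigma> * w s * x s ^ (2 * n - 1 - Suc 0)))) / (x s ^ (2 * n - 1) * x s ^ (2 * n - 1))
      = - (2 * real n - 1) * \<sigma> * q s * w s * inverse (x s)"
    proof -
      have alg: "- (E * (M * (\<sigma> * w s * P))) / ((x s * P) * (x s * P)) = - M * \<sigma> * (E / (x s * P)) * w s * inverse (x s)"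
        if "P > 0" for P M using pos(1)[OF s] that by (simp add: field_simps)
      show ?thesis
        unfolding m q_def cos_phase_def e by (rule alg) (use pos(1)[OF s] in simp)
    qed
    finally show ?thesis by (simp add: q_def[abs_def] cos_phase_def)
  qed
  have w': "(w has_real_derivative (2 * real n - 1) * \<sigma> * (q s)\<^sup>2 * inverse (x s)) (at s)" if s: "s \<in> I" for s
  proof -
    have "1 - (q s)\<^sup>2 > 0" using pos[OF s] zero_less_power[of "w s" 2] by simp
    moreover have "((\<lambda>r. 1 - (q r)\<^sup>2) has_real_derivative
        - 2 * q s * (- (2 * real n - 1) * \<sigma> * q s * w s * inverse (x s))) (at s)"
      using q'[OF s] by (auto intro!: derivative_eq_intros)
    ultimately have "((\<lambda>r. sqrt (1 - (q r)\<^sup>2)) has_real_derivative inverse (sqrt (1 - (q s)\<^sup>2)) / 2 *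
        (- 2 * q s * (- (2 * real n - 1) * \<sigma> * q s * w s * inverse (x s)))) (at s)"
      by (rule DERIV_chain2[OF DERIV_real_sqrt])
    also have "sqrt (1 - (q s)\<^sup>2) = w s" by (simp add: w_def sin_phase_def q_def)
    also have "inverse (w s) / 2 * (- 2 * q s * (- (2 * real n - 1) * \<sigma> * q s * w s * inverse (x s)))
       = (2 * real n - 1) * \<sigma> * (q s)\<^sup>2 * inverse (x s)"
      using pos[OF s] by (simp add: field_simps power2_eq_square)
    finally show ?thesis by (simp add: w_def[abs_def] sin_phase_def q_def)
  qed
  have u': "((\<lambda>r. inverse (x r)) has_real_derivative - 1 * (\<sigma> * w s * inverse (x s) * inverse (x s))) (at s)"
    if s: "s \<in> I" for s
    using DERIV_inverse_fun[OF x'[OF s]] pos(1)[OF s] by (simp add: mult_ac)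
  define B where "B = {x, tcomp \<gamma>, \<lambda>r. inverse (x r), q, w}"
  have gens: "x \<in> polynomials_in B" "tcomp \<gamma> \<in> polynomials_in B" "(\<lambda>r. inverse (x r)) \<in> polynomials_in B"
    "q \<in> polynomials_in B" "w \<in> polynomials_in B"
    by (auto simp: B_def intro: polynomials_in.generator)
  have smooth: "smooth_curve_on I f" if "f \<in> polynomials_in B" for f
  proof (rule smooth_curve_on_polynomials_in[OF ode(1) _ that])
    fix b assume "b \<in> B"
    then consider "b = x" | "b = tcomp \<gamma>" | "b = (\<lambda>r. inverse (x r))" | "b = q" | "b = w"
      unfolding B_def by blast
    then show "\<exists>b'\<in>polynomials_in B. \<forall>s\<in>I. (b has_real_derivative b' s) (at s)"
    proof cases
      case 1
      then show ?thesis using x' by (intro bexI[of _ "\<lambda>s. \<sigma> * w s"]) (auto intro: polynomials_in.intros gens)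
    next
      case 2
      then show ?thesis using t' by (intro bexI[of _ "\<lambda>s. x s * q s"]) (auto intro: polynomials_in.intros gens)
    next
      case 3
      show ?thesis unfolding 3
        by (intro bexI[where x="\<lambda>s. - 1 * (\<sigma> * w s * inverse (x s) * inverse (x s))"] ballI)
          (use u' in blast, intro polynomials_in.const polynomials_in.mult gens)
    next
      case 4
      show ?thesis unfolding 4
        by (intro bexI[where x="\<lambda>s. - (2 * real n - 1) * \<sigma> * q s * w s * inverse (x s)"] ballI)
          (use q' in blast, intro polynomials_in.const polynomials_in.mult gens)
    next
      case 5
      show ?thesis unfolding 5
        by (intro bexI[where x="\<lambda>s. (2 * real n - 1) * \<sigma> * (q s)\<^sup>2 * inverse (x s)"] ballI)
          (use w' in blast, intro polynomials_in.const polynomials_in.mult polynomials_in_power gens)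
    qed
  qed
  have xe: "fst (\<gamma> s) = x s" for s by (simp add: x_def)
  have dx: "deriv (xcomp \<gamma>) s = \<sigma> * w s" and dt: "deriv (tcomp \<gamma>) s = x s * q s" if "s \<in> I" for s
    using x'[OF that] t'[OF that] by (auto simp: x_def DERIV_imp_deriv)
  show gen: "generating_curve I \<gamma>"
    unfolding generating_curve_def
    using ode(1-3) smooth[OF gens(1)] smooth[OF gens(2)] pos dx \<sigma> unfolding x_def by fastforce
  show D: "contact_speed \<gamma> s = xcomp \<gamma> s" if s: "s \<in> I" for s
  proof -
    have "(x s * (\<sigma> * w s))\<^sup>2 + (x s * q s)\<^sup>2 = (x s)\<^sup>2 * ((w s)\<^sup>2 + (q s)\<^sup>2)"
      using \<sigma> by (auto simp: power_mult_distrib algebra_simps)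
    also have "\<dots> = (x s)\<^sup>2" using pos(3)[OF s] by simp
    finally show ?thesis
      unfolding contact_speed_def dx[OF s] dt[OF s] using pos(1)[OF s] by (simp add: xe)
  qed
  show "horizontal_arclength I \<gamma>"
    unfolding horizontal_arclength_def
  proof
    fix s assume s: "s \<in> I"
    show "(deriv (xcomp \<gamma>) s)\<^sup>2 + (deriv (tcomp \<gamma>) s)\<^sup>2 / (xcomp \<gamma> s)\<^sup>2 = 1"
      using pos[OF s] \<sigma> unfolding dx[OF s] dt[OF s]
      by (auto simp: power_mult_distrib xe)
  qed
  show phase: "phase \<gamma> s = Complex (cos_phase n E (xcomp \<gamma> s)) (\<sigma> * sin_phase n E (xcomp \<gamma> s))"
    if s: "s \<in> I" for s
    unfolding phase_def D[OF s] dx[OF s] dt[OF s] using pos(1)[OF s]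
    by (simp add: xe q_def w_def)
  show "((\<lambda>r. phase \<gamma> r) has_vector_derivative
       \<i> * of_real ((2 * real n - 1) * cos_phase n E (xcomp \<gamma> s) / xcomp \<gamma> s) * phase \<gamma> s) (at s)"
    if s: "s \<in> I" for s
  proof -
    have "((\<lambda>r. of_real (q r) + of_real (\<sigma> * w r) * \<i>) has_vector_derivative
       of_real (- (2 * real n - 1) * \<sigma> * q s * w s * inverse (x s))
       + of_real (\<sigma> * ((2 * real n - 1) * \<sigma> * (q s)\<^sup>2 * inverse (x s))) * \<i>) (at s)"
      by (intro has_vector_derivative_add has_vector_derivative_mult_left has_vector_derivative_of_real
          DERIV_cmult q'[OF s] w'[OF s])
    also have "of_real (- (2 * real n - 1) * \<sigma> * q s * w s * inverse (x s))
       + of_real (\<sigma> * ((2 * real n - 1) * \<sigma> * (q s)\<^sup>2 * inverse (x s))) * \<i>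
       = \<i> * of_real ((2 * real n - 1) * cos_phase n E (xcomp \<gamma> s) / xcomp \<gamma> s) * phase \<gamma> s"
      unfolding phase[OF s] using \<sigma> by (auto simp: complex_eq_iff xe q_def[symmetric]
          w_def[symmetric] divide_inverse power2_eq_square algebra_simps)
    finally have "((\<lambda>r. of_real (q r) + of_real (\<sigma> * w r) * \<i>) has_vector_derivative
        \<i> * of_real ((2 * real n - 1) * cos_phase n E (xcomp \<gamma> s) / xcomp \<gamma> s) * phase \<gamma> s) (at s)" .
    then show ?thesis
      by (rule has_vector_derivative_transform_within_open[OF _ ode(1) s])
        (simp add: phase Complex_eq q_def w_def x_def mult.commute)
  qed
qed

text \<open>The rotation speed \<open>(2 n - 1) q / x\<close> of the phase makes \<open>l = (2 n - 2) q / x\<close>, which cancels the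
  contribution of \<open>k = - q / x\<close> to the \<open>p\<close>-mean curvature. Neither \<open>k\<close> nor \<open>l\<close> depends on \<open>\<sigma>\<close>, as
  reflectivity demands.\<close>

lemma explicit_curve_minimal:
  fixes \<gamma> :: "real \<Rightarrow> real \<times> real" and p :: "'n::finite heis"
  assumes \<sigma>: "\<sigma> = 1 \<or> \<sigma> = - 1" and ex: "explicit_curve CARD('n) E \<sigma> I \<gamma>"
    and p: "p \<in> rot_surface I \<gamma>"
  shows "p_mean_curvature I \<gamma> p = 0" "energy I \<gamma> p = E" "0 \<le> \<sigma> * inv_alpha I \<gamma> p"
    "inv_k I \<gamma> p = - cos_phase CARD('n) E (norm (fst p)) / norm (fst p)"
    "inv_l I \<gamma> p = (2 * real CARD('n) - 2) * cos_phase CARD('n) E (norm (fst p)) / norm (fst p)"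
proof -
  have n: "CARD('n) \<ge> 1" by (simp add: Suc_leI)
  note ode = explicit_curve_ode[OF n \<sigma> ex] and e = explicit_generating_curve[OF n \<sigma> ex]
  obtain s where s: "s \<in> I" and ps: "(norm (fst p), snd p) = \<gamma> s"
    using p by (auto simp: rot_surface_def)
  note at = at_point[OF e(1) ode(5) s ps]
  define x q w where "x = norm (fst p)" "q = cos_phase CARD('n) E x" "w = sin_phase CARD('n) E x"
  note defs = this
  have xs: "xcomp \<gamma> s = x" using at(1) by (simp add: defs)
  have xr: "x \<in> x_range CARD('n) E" using ode(4) s xs by blast
  have x: "x > 0" and w: "w > 0" using x_rangeD(1)[OF n xr] sin_phase(1)[OF n xr] by (auto simp: defs)
  have dx: "deriv (xcomp \<gamma>) s = \<sigma> * w" and dt: "deriv (tcomp \<gamma>) s = x * q"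
    using ode(6,7)[OF s] xs by (auto simp: DERIV_imp_deriv defs)
  have D: "contact_speed \<gamma> s = x" using e(2)[OF s] xs by simp
  have k: "inv_k I \<gamma> p = - q / x"
    using inv_k_eq[OF e(1) ode(5) s ps] x by (simp add: D dt xs)
  then show "inv_k I \<gamma> p = - cos_phase CARD('n) E (norm (fst p)) / norm (fst p)"
    by (simp add: defs)
  have l: "inv_l I \<gamma> p = (2 * real CARD('n) - 2) * q / x"
    using inv_l_eq[OF e(1) ode(5) s ps e(5)[OF s]] x
    by (simp add: D dt xs defs(2)[symmetric] left_diff_distrib diff_divide_distrib)
  then show "inv_l I \<gamma> p = (2 * real CARD('n) - 2) * cos_phase CARD('n) E (norm (fst p)) / norm (fst p)"
    by (simp add: defs)
  show H: "p_mean_curvature I \<gamma> p = 0" by (simp add: p_mean_curvature_def k l)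
  have "2 * CARD('n) = Suc (2 * CARD('n) - 1)" using n by simp
  then have "x ^ (2 * CARD('n)) = x * x ^ (2 * CARD('n) - 1)" by (metis power_Suc)
  then show "energy I \<gamma> p = E"
    using x by (simp add: energy_def H k defs(1)[symmetric] defs(2) cos_phase_def)
  show "0 \<le> \<sigma> * inv_alpha I \<gamma> p"
    using inv_alpha_eq[OF e(1) ode(5) s ps] x w \<sigma> by (auto simp: D dx)
qed


section \<open>Existence of profiles\<close>

lemma profile_slope_uminus: "profile_slope n (- E) x = - profile_slope n E x"
  by (simp add: profile_slope_def sin_phase_def cos_phase_def)

text \<open>At the inner boundary \<open>x = a\<close> the slope blows up, but only like an inverse square root.\<close>

lemma profile_slope_bounds:
  assumes n: "n \<ge> 1" and E: "E \<ge> 0" and x: "x \<in> x_range n E"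
  defines "a \<equiv> E powr (1 / (2 * real n - 1))"
  shows "0 \<le> profile_slope n E x" "profile_slope n E x \<le> x * sqrt x / sqrt (x - a)"
proof -
  define m where "m = 2 * n - 1"
  have m: "m > 0" "real m = 2 * real n - 1" using n by (auto simp: m_def)
  have a: "a \<ge> 0" "a < x" using x E by (auto simp: a_def x_range_def)
  have x0: "x > 0" using a by linarith
  have "a ^ m = E"
    using m E unfolding a_def m(2)[symmetric]
    by (cases "E = 0") (auto simp: powr_realpow[symmetric] powr_powr)
  then have q: "cos_phase n E x = (a / x) ^ m"
    unfolding cos_phase_def m_def[symmetric] power_divide by simp
  have ax: "0 \<le> a / x" "a / x \<le> 1" using a x0 by auto
  have q01: "0 \<le> cos_phase n E x" "cos_phase n E x \<le> 1"
    unfolding q using ax by (auto intro: power_le_one)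
  have w: "sin_phase n E x > 0" by (rule sin_phase(1)[OF n x])
  show "0 \<le> profile_slope n E x"
    unfolding profile_slope_def using q01 x0 w by auto
  have "(cos_phase n E x)\<^sup>2 = (a / x) ^ (m * 2)" by (simp add: q power_mult)
  also have "\<dots> \<le> (a / x) ^ 1" using ax m(1) by (intro power_decreasing) auto
  finally have "1 - a / x \<le> 1 - (cos_phase n E x)\<^sup>2" by simp
  then have "sqrt ((x - a) / x) \<le> sin_phase n E x"
    using x0 by (simp add: sin_phase_def diff_divide_distrib)
  then have 1: "sqrt (x - a) / sqrt x \<le> sin_phase n E x" by (simp add: real_sqrt_divide)
  have 2: "0 < sqrt (x - a) / sqrt x" using a x0 by simp
  have "profile_slope n E x \<le> x * 1 / (sqrt (x - a) / sqrt x)"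
    unfolding profile_slope_def using q01 x0 1 2 by (intro frac_le mult_left_mono) auto
  then show "profile_slope n E x \<le> x * sqrt x / sqrt (x - a)" by simp
qed

text \<open>The inverse square root is integrable, so the profile is bounded below near \<open>x = a\<close>, and it is nondecreasing.
  After a vertical translation it is therefore nonnegative, as the form \<open>t = \<plusminus> sqrt (f (|z|\<^sup>2))\<close> requires.\<close>

lemma profile_primitive_nonneg:
  assumes n: "n \<ge> 1" and E: "E \<ge> 0"
  obtains \<tau> where "\<And>x. x \<in> x_range n E \<Longrightarrow> (\<tau> has_real_derivative profile_slope n E x) (at x)"
    "\<And>x. x \<in> x_range n E \<Longrightarrow> \<tau> x \<ge> 0"
proof -
  define a where "a = E powr (1 / (2 * real n - 1))"
  have a: "a \<ge> 0" by (simp add: a_def)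
  have X: "x \<in> x_range n E \<longleftrightarrow> a < x" for x using E by (simp add: x_range_def a_def)
  have "continuous_on (x_range n E) (profile_slope n E)"
    unfolding profile_slope_def using sin_phase(1)[OF n]
    by (intro continuous_intros phase_continuous n) force
  then obtain F where F: "\<And>x. x \<in> x_range n E \<Longrightarrow> (F has_real_derivative profile_slope n E x) (at x)"
    by (rule antiderivative_on_open_interval[OF x_range_interval(1,2)]) (rule that)
  define C where "C = (a + 1) * sqrt (a + 1)"
  have mono: "F x \<le> F y" if "a < x" "x \<le> y" for x y
    using that by (intro DERIV_nonneg_imp_nondecreasing[of x y F])
      (auto simp: X intro!: exI[of _ "profile_slope n E _"] F profile_slope_bounds(1)[OF n E])
  have low: "F (a + 1) - 2 * C \<le> F x" if x: "a < x" for x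
  proof (cases "x \<le> a + 1")
    case True
    \<comment> \<open>\<open>2 C sqrt (y - a)\<close> is a primitive of the bound \<open>C / sqrt (y - a)\<close> for the slope on \<open>{a<..a + 1}\<close>\<close>
    let ?K = "\<lambda>y. F y - 2 * C * sqrt (y - a)"
    have "?K x \<ge> ?K (a + 1)"
    proof (rule DERIV_nonpos_imp_nonincreasing[OF True])
      fix y assume y: "x \<le> y" "y \<le> a + 1"
      have ya: "a < y" "0 < sqrt (y - a)" using x y by auto
      have "(?K has_real_derivative profile_slope n E y - 2 * C * (inverse (sqrt (y - a)) / 2)) (at y)"
        using ya F by (auto simp: X intro!: derivative_eq_intros)
      moreover have "profile_slope n E y - 2 * C * (inverse (sqrt (y - a)) / 2) \<le> 0"
      proof -
        have "profile_slope n E y \<le> y * sqrt y / sqrt (y - a)"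
          using profile_slope_bounds(2)[OF n E] ya by (simp add: X a_def)
        also have "\<dots> \<le> C / sqrt (y - a)"
          unfolding C_def using y ya a by (intro divide_right_mono mult_mono) auto
        also have "\<dots> = 2 * C * (inverse (sqrt (y - a)) / 2)" by (simp add: inverse_eq_divide)
        finally show ?thesis by simp
      qed
      ultimately show "\<exists>z. (?K has_real_derivative z) (at y) \<and> z \<le> 0" by blast
    qed
    then have "F (a + 1) - 2 * C \<le> F x - 2 * C * sqrt (x - a)" by simp
    also have "\<dots> \<le> F x" using a x by (simp add: C_def)
    finally show ?thesis .
  next
    case False
    then have "F (a + 1) \<le> F x" by (intro mono) auto
    moreover have "C \<ge> 0" using a by (simp add: C_def)
    ultimately show ?thesis by linarith
  qed
  show ?thesis
  proof (rule that[of "\<lambda>x. F x - (F (a + 1) - 2 * C)"])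
    show "((\<lambda>x. F x - (F (a + 1) - 2 * C)) has_real_derivative profile_slope n E x) (at x)"
      if "x \<in> x_range n E" for x
      using F[OF that] by (auto intro!: derivative_eq_intros)
    show "0 \<le> F x - (F (a + 1) - 2 * C)" if "x \<in> x_range n E" for x
      using low[of x] that by (simp add: X)
  qed
qed

lemma profile_primitive:
  assumes n: "n \<ge> 1"
  obtains \<tau> where "\<And>x. x \<in> x_range n E \<Longrightarrow> (\<tau> has_real_derivative profile_slope n E x) (at x)"
    "\<And>x. x \<in> x_range n E \<Longrightarrow> if E \<ge> 0 then \<tau> x \<ge> 0 else \<tau> x \<le> 0"
proof (cases "E \<ge> 0")
  case True
  then show ?thesis using profile_primitive_nonneg[OF n True] that by metis
next
  case False
  then obtain \<tau> where \<tau>: "\<And>x. x \<in> x_range n (- E) \<Longrightarrow> (\<tau> has_real_derivative profile_slope n (- E) x) (at x)"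
    "\<And>x. x \<in> x_range n (- E) \<Longrightarrow> \<tau> x \<ge> 0"
    using profile_primitive_nonneg[OF n, of "- E"] by auto
  show ?thesis
  proof (rule that[of "\<lambda>x. - \<tau> x"])
    show "((\<lambda>x. - \<tau> x) has_real_derivative profile_slope n E x) (at x)" if "x \<in> x_range n E" for x
      using DERIV_minus[OF \<tau>(1)[unfolded x_range_uminus, OF that]] by (simp add: profile_slope_uminus)
    show "if E \<ge> 0 then - \<tau> x \<ge> 0 else - \<tau> x \<le> 0" if "x \<in> x_range n E" for x
      using \<tau>(2)[unfolded x_range_uminus, OF that] False by simp
  qed
qed

text \<open>Prescribing the graph \<open>\<tau>\<close> instead of an integral in the parameter fixes the vertical position of the curve.\<close>

lemma explicit_curve_exists:
  assumes n: "n \<ge> 1" and \<sigma>: "\<sigma> = 1 \<or> \<sigma> = - 1"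
    and \<tau>: "\<And>x. x \<in> x_range n E \<Longrightarrow> (\<tau> has_real_derivative \<sigma> * profile_slope n E x) (at x)"
  obtains I \<gamma> where "explicit_curve n E \<sigma> I \<gamma>" "\<gamma> ` I = (\<lambda>x. (x, \<tau> x)) ` x_range n E"
proof -
  let ?X = "x_range n E"
  have "continuous_on ?X (\<lambda>x. 1 / sin_phase n E x)"
    using sin_phase(1)[OF n] by (intro continuous_intros phase_continuous n) force
  then obtain G0 where G0: "\<And>x. x \<in> ?X \<Longrightarrow> (G0 has_real_derivative 1 / sin_phase n E x) (at x)"
    by (rule antiderivative_on_open_interval[OF x_range_interval(1,2)]) (rule that)
  have less: "G0 x < G0 y" if "x \<in> ?X" "y \<in> ?X" "x < y" for x y
  proof (rule DERIV_pos_imp_increasing[OF that(3)])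
    fix z assume "x \<le> z" "z \<le> y"
    then have "z \<in> ?X" using that(1) by (auto simp: x_range_def)
    then show "\<exists>d. (G0 has_real_derivative d) (at z) \<and> d > 0" using G0 sin_phase(1)[OF n] by force
  qed
  define G where "G x = \<sigma> * G0 x" for x
  have G: "(G has_real_derivative \<sigma> / sin_phase n E x) (at x)" if "x \<in> ?X" for x
    unfolding G_def[abs_def] using DERIV_cmult[OF G0[OF that], of \<sigma>] by simp
  have inj: "inj_on G ?X"
  proof (rule linorder_inj_onI')
    fix x y assume "x \<in> ?X" "y \<in> ?X" "x < y"
    from less[OF this] show "G x \<noteq> G y" using \<sigma> by (auto simp: G_def)
  qed
  define \<gamma> where "\<gamma> s = (inv_into ?X G s, \<tau> (inv_into ?X G s))" for s
  have inv: "inv_into ?X G (G x) = x" if "x \<in> ?X" for x by (rule inv_into_f_f[OF inj that])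
  have "explicit_curve n E \<sigma> (G ` ?X) \<gamma>"
    unfolding explicit_curve_def
  proof (intro exI[of _ G] conjI ballI)
    show "(G has_real_derivative \<sigma> / sqrt (1 - (E / x ^ (2 * n - 1))\<^sup>2)) (at x)" if "x \<in> ?X" for x
      using G[OF that] by (simp add: sin_phase_def cos_phase_def)
    show "inj_on G ?X" by (rule inj)
    show "G ` ?X = G ` ?X" ..
    show "xcomp \<gamma> s = inv_into ?X G s" for s by (simp add: \<gamma>_def)
    fix s assume "s \<in> G ` ?X"
    then obtain x where x: "x \<in> ?X" "s = G x" by blast
    have sp: "sin_phase n E x > 0" by (rule sin_phase(1)[OF n x(1)])
    have inv': "(inv_into ?X G has_real_derivative inverse (\<sigma> / sin_phase n E x)) (at s)"
      unfolding x(2) using G sp \<sigma>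
      by (intro inv_into_derivative[OF x_range_interval(1) inj x(1)]) auto
    have "(\<tau> has_real_derivative \<sigma> * profile_slope n E x) (at (inv_into ?X G s))"
      using \<tau>[OF x(1)] by (simp add: x(2) inv[OF x(1)])
    from DERIV_chain2[OF this inv'] have "(tcomp \<gamma> has_real_derivative \<sigma> * profile_slope n E x * inverse (\<sigma> / sin_phase n E x)) (at s)"
      unfolding \<gamma>_def snd_conv .
    also have "\<sigma> * profile_slope n E x * inverse (\<sigma> / sin_phase n E x) = x * cos_phase n E x"
      using \<sigma> sp by (auto simp: profile_slope_def)
    also have "\<dots> = E / xcomp \<gamma> s ^ (2 * n - 2)"
      using x_times_cos_phase[OF n x_rangeD(1)[OF n x(1)]] by (simp add: \<gamma>_def x(2) inv[OF x(1)])
    finally show "(tcomp \<gamma> has_real_derivative E / xcomp \<gamma> s ^ (2 * n - 2)) (at s)" .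
  qed
  moreover have "\<gamma> ` G ` ?X = (\<lambda>x. (x, \<tau> x)) ` ?X"
    unfolding image_image by (intro image_cong refl) (simp add: \<gamma>_def inv)
  ultimately show ?thesis by (rule that)
qed

lemma explicit_curve_translate:
  assumes "explicit_curve n E \<sigma> I \<gamma>"
  shows "explicit_curve n E \<sigma> I (\<lambda>s. translate_t c (\<gamma> s))"
proof -
  have "((\<lambda>s. tcomp \<gamma> s + c) has_real_derivative d) (at s)"
    if "(tcomp \<gamma> has_real_derivative d) (at s)" for d s
    using that by (auto intro!: derivative_eq_intros)
  then show ?thesis using assms unfolding explicit_curve_def translate_t_def by fastforce
qed

lemma rot_surface_graph:
  assumes "\<gamma> ` I = (\<lambda>x. (x, \<tau> x)) ` X"
  shows "rot_surface I \<gamma> = {p :: 'n::finite heis. norm (fst p) \<in> X \<and> snd p = \<tau> (norm (fst p))}"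
proof -
  have "p \<in> rot_surface I \<gamma> \<longleftrightarrow> (norm (fst p), snd p) \<in> \<gamma> ` I" for p :: "'n heis"
    by (auto simp: rot_surface_def)
  then show ?thesis unfolding assms by auto
qed

lemma explicit_curve_graph:
  assumes n: "n \<ge> 1" and \<sigma>: "\<sigma> = 1 \<or> \<sigma> = - 1" and ex: "explicit_curve n E \<sigma> I \<gamma>"
  obtains \<tau> where "\<gamma> ` I = (\<lambda>x. (x, \<tau> x)) ` x_range n E"
    "\<And>x. x \<in> x_range n E \<Longrightarrow> (\<tau> has_real_derivative \<sigma> * profile_slope n E x) (at x)"
proof -
  note ode = explicit_curve_ode[OF n \<sigma> ex] and e = explicit_generating_curve[OF n \<sigma> ex]
  show ?thesis
  proof (rule graph_slope[OF e(1) ode(5) n ode(4) \<sigma>])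
    fix s assume s: "s \<in> I"
    show "deriv (tcomp \<gamma>) s = contact_speed \<gamma> s * cos_phase n E (xcomp \<gamma> s)"
      using DERIV_imp_deriv[OF ode(7)[OF s]] e(2)[OF s] by simp
    show "xcomp \<gamma> s * deriv (xcomp \<gamma>) s = contact_speed \<gamma> s * (\<sigma> * sin_phase n E (xcomp \<gamma> s))"
      using DERIV_imp_deriv[OF ode(6)[OF s]] e(2)[OF s] by simp
  qed (rule that)
qed

text \<open>Explicit curves of opposite sign have opposite slopes. Once their vertical positions match, as they do here,
  reflection interchanges the two hypersurfaces.\<close>

lemma explicit_pair_reflective_minimal:
  assumes plus: "explicit_curve CARD('n::finite) E 1 Iplus \<gamma>plus"
    and minus: "explicit_curve CARD('n) E (- 1) Iminus \<gamma>minus"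
    and graphs: "\<gamma>plus ` Iplus = (\<lambda>x. (x, \<tau> x)) ` x_range CARD('n) E"
      "\<gamma>minus ` Iminus = (\<lambda>x. (x, - \<tau> x)) ` x_range CARD('n) E"
  shows "reflective_minimal E (rot_surface Iplus \<gamma>plus \<union> rot_surface Iminus \<gamma>minus :: 'n heis set)
     Iplus \<gamma>plus Iminus \<gamma>minus"
proof -
  have n: "CARD('n) \<ge> 1" by (simp add: Suc_leI)
  have signs: "(1::real) = 1 \<or> (1::real) = - 1" "(- 1::real) = 1 \<or> (- 1::real) = - 1" by auto
  note p = explicit_curve_ode(4,5)[OF n signs(1) plus] explicit_generating_curve(1)[OF n signs(1) plus]
    and m = explicit_curve_ode(4,5)[OF n signs(2) minus] explicit_generating_curve(1)[OF n signs(2) minus]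
  note pm = explicit_curve_minimal[OF signs(1) plus] and mm = explicit_curve_minimal[OF signs(2) minus]
  have reflected: "reflection ` (rot_surface Iplus \<gamma>plus :: 'n heis set) = rot_surface Iminus \<gamma>minus"
    unfolding rot_surface_graph[OF graphs(1)] rot_surface_graph[OF graphs(2)]
  proof (intro set_eqI iffI)
    fix q :: "'n heis"
    assume "q \<in> {p. norm (fst p) \<in> x_range CARD('n) E \<and> snd p = - \<tau> (norm (fst p))}"
    then show "q \<in> reflection ` {p. norm (fst p) \<in> x_range CARD('n) E \<and> snd p = \<tau> (norm (fst p))}"
      by (intro image_eqI[of _ _ "reflection q"]) (auto simp: reflection_def prod_eq_iff)
  qed (auto simp: reflection_def)
  have "reflective (rot_surface Iplus \<gamma>plus \<union> rot_surface Iminus \<gamma>minus :: 'n heis set)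
     Iplus \<gamma>plus Iminus \<gamma>minus"
    unfolding reflective_def
  proof (intro conjI ballI impI)
    fix q1 q2 :: "'n heis"
    assume q: "q1 \<in> rot_surface Iplus \<gamma>plus" "q2 \<in> rot_surface Iminus \<gamma>minus" "norm (fst q1) = norm (fst q2)"
    show "inv_k Iplus \<gamma>plus q1 = inv_k Iminus \<gamma>minus q2"
      using pm(4)[OF q(1)] mm(4)[OF q(2)] q(3) by simp
    show "inv_l Iplus \<gamma>plus q1 = inv_l Iminus \<gamma>minus q2"
      using pm(5)[OF q(1)] mm(5)[OF q(2)] q(3) by simp
  next
    show "0 \<le> inv_alpha Iplus \<gamma>plus q" if "q \<in> rot_surface Iplus \<gamma>plus" for q :: "'n heis"
      using pm(3)[OF that] by simp
    show "inv_alpha Iminus \<gamma>minus q \<le> 0" if "q \<in> rot_surface Iminus \<gamma>minus" for q :: "'n heis"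
      using mm(3)[OF that] by simp
  qed (use p m reflected in auto)
  then show ?thesis
    unfolding reflective_minimal_def using p m pm(1,2) mm(1,2) by auto
qed

section \<open>Uniqueness and the theorem\<close>

lemma primitives_differ_by_constant:
  assumes "convex X" and "\<And>x. x \<in> X \<Longrightarrow> (f has_real_derivative h x) (at x)"
    and "\<And>x. x \<in> X \<Longrightarrow> (g has_real_derivative h x) (at x)"
  obtains c where "\<And>x. x \<in> X \<Longrightarrow> g x = f x + c"
proof -
  have "((\<lambda>x. g x - f x) has_real_derivative 0) (at x within X)" if "x \<in> X" for x
    using DERIV_diff[OF assms(3)[OF that] assms(2)[OF that]] has_field_derivative_at_within by auto
  from has_field_derivative_zero_constant[OF assms(1) this]
  obtain c where "\<forall>x\<in>X. g x - f x = c" by blast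
  then show ?thesis using that[of c] by (auto simp: algebra_simps)
qed

lemma reflective_minimal_phase:
  assumes rm: "reflective_minimal E (S :: 'n::finite heis set) Iplus \<gamma>plus Iminus \<gamma>minus"
  shows "generating_curve Iplus \<gamma>plus" "inj_on (xcomp \<gamma>plus) Iplus"
    "xcomp \<gamma>plus ` Iplus = x_range CARD('n) E"
    "\<And>s. s \<in> Iplus \<Longrightarrow> deriv (tcomp \<gamma>plus) s
        = contact_speed \<gamma>plus s * cos_phase CARD('n) E (xcomp \<gamma>plus s)"
    "\<And>s. s \<in> Iplus \<Longrightarrow> xcomp \<gamma>plus s * deriv (xcomp \<gamma>plus) s
        = contact_speed \<gamma>plus s * (1 * sin_phase CARD('n) E (xcomp \<gamma>plus s))"
    "generating_curve Iminus \<gamma>minus" "inj_on (xcomp \<gamma>minus) Iminus"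
    "xcomp \<gamma>minus ` Iminus = x_range CARD('n) E"
    "\<And>s. s \<in> Iminus \<Longrightarrow> deriv (tcomp \<gamma>minus) s
        = contact_speed \<gamma>minus s * cos_phase CARD('n) E (xcomp \<gamma>minus s)"
    "\<And>s. s \<in> Iminus \<Longrightarrow> xcomp \<gamma>minus s * deriv (xcomp \<gamma>minus) s
        = contact_speed \<gamma>minus s * (- 1 * sin_phase CARD('n) E (xcomp \<gamma>minus s))"
proof -
  note rmd = rm[unfolded reflective_minimal_def reflective_def]
  show p: "generating_curve Iplus \<gamma>plus" "inj_on (xcomp \<gamma>plus) Iplus"
    "xcomp \<gamma>plus ` Iplus = x_range CARD('n) E" using rmd by blast+
  show m: "generating_curve Iminus \<gamma>minus" "inj_on (xcomp \<gamma>minus) Iminus"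
    "xcomp \<gamma>minus ` Iminus = x_range CARD('n) E" using rmd by blast+
  have pp: "p_mean_curvature Iplus \<gamma>plus p = 0 \<and> energy Iplus \<gamma>plus p = E"
      "0 \<le> 1 * inv_alpha Iplus \<gamma>plus p" if "p \<in> rot_surface Iplus \<gamma>plus" for p :: "'n heis"
    using rmd that by simp_all
  have mm: "p_mean_curvature Iminus \<gamma>minus p = 0 \<and> energy Iminus \<gamma>minus p = E"
      "0 \<le> - 1 * inv_alpha Iminus \<gamma>minus p" if "p \<in> rot_surface Iminus \<gamma>minus" for p :: "'n heis"
    using rmd that by simp_all
  show "deriv (tcomp \<gamma>plus) s = contact_speed \<gamma>plus s * cos_phase CARD('n) E (xcomp \<gamma>plus s)"
    "xcomp \<gamma>plus s * deriv (xcomp \<gamma>plus) s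
        = contact_speed \<gamma>plus s * (1 * sin_phase CARD('n) E (xcomp \<gamma>plus s))" if "s \<in> Iplus" for s
    by (rule minimal_phase[OF p(1,2) eq_refl[OF p(3)] pp _ that]; simp)+
  show "deriv (tcomp \<gamma>minus) s = contact_speed \<gamma>minus s * cos_phase CARD('n) E (xcomp \<gamma>minus s)"
    "xcomp \<gamma>minus s * deriv (xcomp \<gamma>minus) s
        = contact_speed \<gamma>minus s * (- 1 * sin_phase CARD('n) E (xcomp \<gamma>minus s))" if "s \<in> Iminus" for s
    by (rule minimal_phase[OF m(1,2) eq_refl[OF m(3)] mm _ that]; simp)+
qed

(* The conjuncts: existence; uniqueness of the generating curves up to translations along the
   t-axis; in horizontal arc-length the generating curves are the explicit ones; every choice of
   the antiderivatives occurs, once the vertical offset between the two parts is adjusted. *)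
theorem mainTheorem3:
  fixes E :: real
  shows
    "(\<exists>(S :: 'n::finite heis set) Iplus \<gamma>plus Iminus \<gamma>minus.
        reflective_minimal E S Iplus \<gamma>plus Iminus \<gamma>minus \<and>
        horizontal_arclength Iplus \<gamma>plus \<and> horizontal_arclength Iminus \<gamma>minus \<and>
        (if E \<ge> 0
         then sqrt_normalised (x_range CARD('n) E)
                (rot_surface Iplus \<gamma>plus :: 'n heis set) (rot_surface Iminus \<gamma>minus)
         else sqrt_normalised (x_range CARD('n) E)
                (rot_surface Iminus \<gamma>minus :: 'n heis set) (rot_surface Iplus \<gamma>plus))) \<and>
     (\<forall>(S :: 'n heis set) Iplus \<gamma>plus Iminus \<gamma>minus
        (S' :: 'n heis set) Iplus' \<gamma>plus' Iminus' \<gamma>minus'.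
        reflective_minimal E S Iplus \<gamma>plus Iminus \<gamma>minus \<and>
        reflective_minimal E S' Iplus' \<gamma>plus' Iminus' \<gamma>minus' \<longrightarrow>
        (\<exists>c. \<gamma>plus' ` Iplus' = translate_t c ` \<gamma>plus ` Iplus \<and>
             \<gamma>minus' ` Iminus' = translate_t (- c) ` \<gamma>minus ` Iminus)) \<and>
     (\<forall>(S :: 'n heis set) Iplus \<gamma>plus Iminus \<gamma>minus.
        reflective_minimal E S Iplus \<gamma>plus Iminus \<gamma>minus \<and>
        horizontal_arclength Iplus \<gamma>plus \<and> horizontal_arclength Iminus \<gamma>minus \<longrightarrow>
        explicit_curve CARD('n) E 1 Iplus \<gamma>plus \<and>
        explicit_curve CARD('n) E (- 1) Iminus \<gamma>minus) \<and>
     (\<forall>Iplus \<gamma>plus Iminus \<gamma>minus.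
        explicit_curve CARD('n) E 1 Iplus \<gamma>plus \<and>
        explicit_curve CARD('n) E (- 1) Iminus \<gamma>minus \<longrightarrow>
        horizontal_arclength Iplus \<gamma>plus \<and> horizontal_arclength Iminus \<gamma>minus \<and>
        (\<exists>c. reflective_minimal E
               (rot_surface Iplus \<gamma>plus \<union> rot_surface Iminus (\<lambda>s. translate_t c (\<gamma>minus s)) :: 'n heis set)
               Iplus \<gamma>plus Iminus (\<lambda>s. translate_t c (\<gamma>minus s))))"
proof (intro conjI)
  have n: "CARD('n) \<ge> 1" by (simp add: Suc_leI)
  have signs: "(1::real) = 1 \<or> (1::real) = - 1" "(- 1::real) = 1 \<or> (- 1::real) = - 1" by auto
  let ?X = "x_range CARD('n) E"

  show "\<exists>(S :: 'n heis set) Iplus \<gamma>plus Iminus \<gamma>minus.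
        reflective_minimal E S Iplus \<gamma>plus Iminus \<gamma>minus \<and>
        horizontal_arclength Iplus \<gamma>plus \<and> horizontal_arclength Iminus \<gamma>minus \<and>
        (if E \<ge> 0
         then sqrt_normalised ?X (rot_surface Iplus \<gamma>plus :: 'n heis set) (rot_surface Iminus \<gamma>minus)
         else sqrt_normalised ?X (rot_surface Iminus \<gamma>minus :: 'n heis set) (rot_surface Iplus \<gamma>plus))"
  proof -
    obtain \<tau> where \<tau>: "\<And>x. x \<in> ?X \<Longrightarrow> (\<tau> has_real_derivative profile_slope CARD('n) E x) (at x)"
      and sgn: "\<And>x. x \<in> ?X \<Longrightarrow> if E \<ge> 0 then \<tau> x \<ge> 0 else \<tau> x \<le> 0"
      by (rule profile_primitive[OF n]) (rule that)
    obtain Iplus \<gamma>plus where plus: "explicit_curve CARD('n) E 1 Iplus \<gamma>plus"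
      "\<gamma>plus ` Iplus = (\<lambda>x. (x, \<tau> x)) ` ?X"
      by (rule explicit_curve_exists[OF n signs(1), where \<tau> = \<tau>]) (use \<tau> in auto)
    have neg: "((\<lambda>x. - \<tau> x) has_real_derivative - 1 * profile_slope CARD('n) E x) (at x)" if "x \<in> ?X" for x
      using DERIV_minus[OF \<tau>[OF that]] by simp
    obtain Iminus \<gamma>minus where minus: "explicit_curve CARD('n) E (- 1) Iminus \<gamma>minus"
      "\<gamma>minus ` Iminus = (\<lambda>x. (x, - \<tau> x)) ` ?X"
      by (rule explicit_curve_exists[OF n signs(2) neg]) (assumption, rule that)
    \<comment> \<open>for \<open>E < 0\<close> the function \<open>\<tau>\<close> is nonpositive, so the two parts exchange their roles\<close>
    define f where "f r = (\<tau> (sqrt r))\<^sup>2" for r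
    have f: "sqrt (f (x\<^sup>2)) = (if E \<ge> 0 then \<tau> x else - \<tau> x)" "f (x\<^sup>2) \<ge> 0" if "x \<in> ?X" for x
      using sgn[OF that] x_rangeD(1)[OF n that] by (auto simp: f_def split: if_splits)
    have "if E \<ge> 0
         then sqrt_normalised ?X (rot_surface Iplus \<gamma>plus :: 'n heis set) (rot_surface Iminus \<gamma>minus)
         else sqrt_normalised ?X (rot_surface Iminus \<gamma>minus :: 'n heis set) (rot_surface Iplus \<gamma>plus)"
      unfolding rot_surface_graph[OF plus(2)] rot_surface_graph[OF minus(2)] sqrt_normalised_def
      using f by (auto intro!: exI[of _ f])
    then show ?thesis
      using explicit_pair_reflective_minimal[OF plus(1) minus(1) plus(2) minus(2)]
        explicit_generating_curve(3)[OF n signs(1) plus(1)] explicit_generating_curve(3)[OF n signs(2) minus(1)]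
      by blast
  qed

  show "\<forall>(S :: 'n heis set) Iplus \<gamma>plus Iminus \<gamma>minus
        (S' :: 'n heis set) Iplus' \<gamma>plus' Iminus' \<gamma>minus'.
        reflective_minimal E S Iplus \<gamma>plus Iminus \<gamma>minus \<and>
        reflective_minimal E S' Iplus' \<gamma>plus' Iminus' \<gamma>minus' \<longrightarrow>
        (\<exists>c. \<gamma>plus' ` Iplus' = translate_t c ` \<gamma>plus ` Iplus \<and>
             \<gamma>minus' ` Iminus' = translate_t (- c) ` \<gamma>minus ` Iminus)"
  proof (intro allI impI, elim conjE)
    fix S S' :: "'n heis set" and Iplus \<gamma>plus Iminus \<gamma>minus Iplus' \<gamma>plus' Iminus' \<gamma>minus'
    assume rm: "reflective_minimal E S Iplus \<gamma>plus Iminus \<gamma>minus"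
      and rm': "reflective_minimal E S' Iplus' \<gamma>plus' Iminus' \<gamma>minus'"
    note ph = reflective_minimal_phase[OF rm] and ph' = reflective_minimal_phase[OF rm']
    obtain \<tau> where \<tau>: "\<gamma>plus ` Iplus = (\<lambda>x. (x, \<tau> x)) ` ?X"
      "\<And>x. x \<in> ?X \<Longrightarrow> (\<tau> has_real_derivative 1 * profile_slope CARD('n) E x) (at x)"
      by (rule graph_slope[OF ph(1,2) n ph(3) signs(1) ph(4,5)]) (auto intro: that)
    obtain \<tau>' where \<tau>': "\<gamma>plus' ` Iplus' = (\<lambda>x. (x, \<tau>' x)) ` ?X"
      "\<And>x. x \<in> ?X \<Longrightarrow> (\<tau>' has_real_derivative 1 * profile_slope CARD('n) E x) (at x)"
      by (rule graph_slope[OF ph'(1,2) n ph'(3) signs(1) ph'(4,5)]) (auto intro: that)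
    obtain c where c: "\<And>x. x \<in> ?X \<Longrightarrow> \<tau>' x = \<tau> x + c"
      by (rule primitives_differ_by_constant[OF x_range_interval(4) \<tau>(2) \<tau>'(2)]) (auto intro: that)
    have plus: "\<gamma>plus' ` Iplus' = translate_t c ` \<gamma>plus ` Iplus"
      unfolding \<tau>(1) \<tau>'(1) image_image by (intro image_cong refl) (simp add: c translate_t_def)
    \<comment> \<open>reflection carries the translation of the first part over to the second, with the opposite sign\<close>
    have "\<gamma>minus ` Iminus = (\<lambda>a. (fst a, - snd a)) ` \<gamma>plus ` Iplus"
      using rm generating_curveD(1)[OF ph(1)] generating_curveD(1)[OF ph(6)]
      by (intro reflected_generating_curve[where 'n = 'n])
        (auto simp: reflective_minimal_def reflective_def)
    moreover have "\<gamma>minus' ` Iminus' = (\<lambda>a. (fst a, - snd a)) ` \<gamma>plus' ` Iplus'"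
      using rm' generating_curveD(1)[OF ph'(1)] generating_curveD(1)[OF ph'(6)]
      by (intro reflected_generating_curve[where 'n = 'n])
        (auto simp: reflective_minimal_def reflective_def)
    ultimately have "\<gamma>minus' ` Iminus' = translate_t (- c) ` \<gamma>minus ` Iminus"
      by (simp add: plus image_image translate_t_def)
    with plus show "\<exists>c. \<gamma>plus' ` Iplus' = translate_t c ` \<gamma>plus ` Iplus \<and>
             \<gamma>minus' ` Iminus' = translate_t (- c) ` \<gamma>minus ` Iminus" by blast
  qed

  show "\<forall>(S :: 'n heis set) Iplus \<gamma>plus Iminus \<gamma>minus.
        reflective_minimal E S Iplus \<gamma>plus Iminus \<gamma>minus \<and>
        horizontal_arclength Iplus \<gamma>plus \<and> horizontal_arclength Iminus \<gamma>minus \<longrightarrow>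
        explicit_curve CARD('n) E 1 Iplus \<gamma>plus \<and>
        explicit_curve CARD('n) E (- 1) Iminus \<gamma>minus"
  proof (intro allI impI, elim conjE, intro conjI)
    fix S :: "'n heis set" and Iplus \<gamma>plus Iminus \<gamma>minus
    assume rm: "reflective_minimal E S Iplus \<gamma>plus Iminus \<gamma>minus"
      and arc: "horizontal_arclength Iplus \<gamma>plus" "horizontal_arclength Iminus \<gamma>minus"
    note ph = reflective_minimal_phase[OF rm]
    show "explicit_curve CARD('n) E 1 Iplus \<gamma>plus"
      by (rule arclength_imp_explicit[OF ph(1,2) n ph(3) signs(1) ph(4,5) arc(1)])
    show "explicit_curve CARD('n) E (- 1) Iminus \<gamma>minus"
      by (rule arclength_imp_explicit[OF ph(6,7) n ph(8) signs(2) ph(9,10) arc(2)])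
  qed

  show "\<forall>Iplus \<gamma>plus Iminus \<gamma>minus.
        explicit_curve CARD('n) E 1 Iplus \<gamma>plus \<and>
        explicit_curve CARD('n) E (- 1) Iminus \<gamma>minus \<longrightarrow>
        horizontal_arclength Iplus \<gamma>plus \<and> horizontal_arclength Iminus \<gamma>minus \<and>
        (\<exists>c. reflective_minimal E
               (rot_surface Iplus \<gamma>plus \<union> rot_surface Iminus (\<lambda>s. translate_t c (\<gamma>minus s)) :: 'n heis set)
               Iplus \<gamma>plus Iminus (\<lambda>s. translate_t c (\<gamma>minus s)))"
  proof (intro allI impI, elim conjE, intro conjI)
    fix Iplus \<gamma>plus Iminus \<gamma>minus
    assume plus: "explicit_curve CARD('n) E 1 Iplus \<gamma>plus"
      and minus: "explicit_curve CARD('n) E (- 1) Iminus \<gamma>minus"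
    show "horizontal_arclength Iplus \<gamma>plus" by (rule explicit_generating_curve(3)[OF n signs(1) plus])
    show "horizontal_arclength Iminus \<gamma>minus" by (rule explicit_generating_curve(3)[OF n signs(2) minus])
    obtain \<tau> where \<tau>: "\<gamma>plus ` Iplus = (\<lambda>x. (x, \<tau> x)) ` ?X"
      "\<And>x. x \<in> ?X \<Longrightarrow> (\<tau> has_real_derivative 1 * profile_slope CARD('n) E x) (at x)"
      by (rule explicit_curve_graph[OF n signs(1) plus]) (auto intro: that)
    obtain \<rho> where \<rho>: "\<gamma>minus ` Iminus = (\<lambda>x. (x, \<rho> x)) ` ?X"
      "\<And>x. x \<in> ?X \<Longrightarrow> (\<rho> has_real_derivative - 1 * profile_slope CARD('n) E x) (at x)"
      by (rule explicit_curve_graph[OF n signs(2) minus]) (auto intro: that)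
    have "((\<lambda>x. - \<tau> x) has_real_derivative - 1 * profile_slope CARD('n) E x) (at x)" if "x \<in> ?X" for x
      using DERIV_minus[OF \<tau>(2)[OF that]] by simp
    from primitives_differ_by_constant[OF x_range_interval(4) \<rho>(2) this]
    obtain c where c: "\<And>x. x \<in> ?X \<Longrightarrow> - \<tau> x = \<rho> x + c" by metis
    have "(\<lambda>s. translate_t c (\<gamma>minus s)) ` Iminus = translate_t c ` \<gamma>minus ` Iminus"
      by (simp add: image_image)
    also have "\<dots> = (\<lambda>x. (x, - \<tau> x)) ` ?X"
      unfolding \<rho>(1) image_image by (intro image_cong refl) (simp add: c translate_t_def)
    finally show "\<exists>c. reflective_minimal E
               (rot_surface Iplus \<gamma>plus \<union> rot_surface Iminus (\<lambda>s. translate_t c (\<gamma>minus s)) :: 'n heis set)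
               Iplus \<gamma>plus Iminus (\<lambda>s. translate_t c (\<gamma>minus s))"
      using explicit_pair_reflective_minimal[OF plus explicit_curve_translate[OF minus] \<tau>(1)] by blast
  qed
qed

end
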